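(* There is a constant $K>0$ such that for every integer $n\ge1$ with $\frac{1}{\sqrt5}-\frac{K}{n}\ge 0$ and every sufficiently small $r>0$ (how small may depend on $n$), the admissible homotopical rotation set $AR$ of the billiard flow on $Q_n$ satisfies $$B\left(0,\frac{1}{\sqrt5}-\frac{K}{n}\right)\subset AR.$$ That is, $B\left(0,\frac{1}{\sqrt5}-\mathcal{O}(\frac1n)\right)\subset AR$.
   Context: Billiard. $Q_n=\mathbb{T}^2\setminus\bigcup_{i=0}^{n-1}D_i$, where $\mathbb{T}^2=\mathbb{R}^2/\mathbb{Z}^2$ and $D_i$ is the (open) disk of radius $r$ centered at $(i/n,0)$ mod $\mathbb{Z}^2$; $r$ is small, in particular the disks are pairwise disjoint. The billiard flow $S^t$ is the motion of a point particle with unit speed in $Q_n$ with elastic (specular) reflections at the boundaries of the disks. For a phase point $x_0$ write $S^tx_0=(x(t),x'(t))$ (position, velocity), and $S^{[0,T]}x_0=\{S^tx_0 : 0\le t\le T\}$ for a trajectory segment. Fundamental group. $\pi_1(Q_n)$ is the free group $F_{n+1}$ with free generators $a,b_1,\dots,b_n$. The generator $a$ corresponds to crossing the wall $\{0\}\times[r,1-r]$ (mod $\mathbb{Z}^2$) in the positive direction, and $b_i$ corresponds to crossing the wall $[\frac{i-1}{n}+r,\frac{i}{n}-r]\times\{0\}$ (mod $\mathbb{Z}^2$) in the positive direction; crossings in the negative directions correspond to the inverses. Cutting $Q_n$ along these walls gives a simply connected cell. To a trajectory segment $S^{[0,T]}x_0$ one associates the element $g\in\pi_1(Q_n)$ given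 by its wall-crossing word (equivalently, the class of the loop obtained by joining the two endpoints of $\{x(t):0\le t\le T\}$ to a base point inside the cell without crossing walls). Let $|g|=\mathrm{dist}(g,1)$ be the word length of $g$ (length of the reduced word) with respect to the free generators $a,b_1,\dots,b_n$. Cone. $\mathrm{Ends}(\pi_1(Q_n))$ is the ideal boundary (a Cantor set) of the free group, i.e. the set of infinite reduced words $w_0w_1w_2\dots$ in the letters $a^{\pm1},b_i^{\pm1}$ with its usual topology. Let $C=([0,\infty)\times \mathrm{Ends}(\pi_1(Q_n)))/(\{0\}\times \mathrm{Ends}(\pi_1(Q_n)))$ be the cone over it, with vertex $0$. For $\rho\ge0$, $B(0,\rho)=\{(s,e)\in C: s\le\rho\}$. Admissibility. Lift a trajectory segment and the scatterers; in the plane $\mathbb{R}^2$ the lifted scatterers (obstacles) are the disks of radius $r$ centered at the points $(j/n,k)$, $j,k\in\mathbb{Z}$. The segment is admissible if the sequence of lifted obstacles it visits at its consecutive collisions satisfies: (i) any two consecutively visited obstacles are different and the convex hull of the two does not intersect any other obstacle; (ii) the obstacle visited at the $k$-th collision ($k\ge2$, whenever there is a $(k+1)$-st collision) does not intersect the convex hull of the obstacles visited at the $(k-1)$-st and $(k+1)$-st collisions. Admissible rotation set. $AR\subset C$ is the set of all $(s,e)\in C$ for which there are admissible trajectory segments $S^{[0,T_m]}x_m$ with $T_m\to\infty$ and associated elements $g_m\in\pi_1(Q_n)$ such that $|g_m|/T_m\to s$ and, if $s>0$, $g_m\to e$ (i.e. for each $k$ the initial subword of length $k$ of the reduced word of $g_m$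 eventually equals that of $e$). The vertex belongs to $AR$ if and only if such a sequence exists with $|g_m|/T_m\to 0$. *)

theory Defs
  imports "HOL-Analysis.Analysis"
begin

section \<open>The billiard flow\<close>

text \<open>
  A trajectory on the torus table is described by its lift to the plane, which is unique up to
  translation by integer vectors; every notion below that is used for trajectories is invariant
  under these translations. The obstacle with label \<open>(j, k)\<close> is a lift of \<open>D\<^sub>i\<close> with
  \<open>i = j mod n\<close>.
\<close>

type_synonym plane = "real \<times> real"

definition center :: "nat \<Rightarrow> int \<times> int \<Rightarrow> plane" where
  "center n q = (of_int (fst q) / of_nat n, of_int (snd q))"

definition obstacle :: "nat \<Rightarrow> real \<Rightarrow> int \<times> int \<Rightarrow> plane set" where
  "obstacle n r q = ball (center n q) r"

definition table :: "nat \<Rightarrow> real \<Rightarrow> plane set" where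
  "table n r = - (\<Union>q. obstacle n r q)"

definition collision_times :: "nat \<Rightarrow> real \<Rightarrow> real \<Rightarrow> (real \<Rightarrow> plane) \<Rightarrow> real set" where
  "collision_times n r T x = {t \<in> {0..T}. \<exists>q. x t \<in> frontier (obstacle n r q)}"

text \<open>Specular reflection of the velocity \<open>w\<close> in the line orthogonal to the unit vector \<open>\<nu>\<close>.\<close>

definition reflect :: "plane \<Rightarrow> plane \<Rightarrow> plane" where
  "reflect \<nu> w = w - (2 * (w \<bullet> \<nu>)) *\<^sub>R \<nu>"

text \<open>
  \<open>x\<close> and \<open>v\<close> are position and velocity along \<open>S\<^sup>t x\<^sub>0\<close>, \<open>0 \<le> t \<le> T\<close>. At a collision \<open>v t\<close> is the
  outgoing velocity and the left limit \<open>w\<close> of \<open>v\<close> is the incoming one. A tangency counts as a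
  collision; the reflection law then leaves the velocity unchanged. For disjoint disks a billiard
  orbit has only finitely many collisions in bounded time; finiteness is demanded in order to
  exclude curves that slide along the boundary of an obstacle.
\<close>

definition billiard_segment ::
    "nat \<Rightarrow> real \<Rightarrow> real \<Rightarrow> (real \<Rightarrow> plane) \<Rightarrow> (real \<Rightarrow> plane) \<Rightarrow> bool" where
  "billiard_segment n r T x v \<longleftrightarrow>
     0 \<le> T \<and>
     (\<forall>t\<in>{0..T}. x t \<in> table n r \<and> norm (v t) = 1) \<and>
     finite (collision_times n r T x) \<and>
     (\<forall>s t. 0 \<le> s \<and> s < t \<and> t \<le> T \<and> {s<..<t} \<inter> collision_times n r T x = {} \<longrightarrow>
        x t = x s + (t - s) *\<^sub>R v s \<and>
        (t \<notin> collision_times n r T x \<longrightarrow> v t = v s)) \<and>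
     (\<forall>t q. 0 < t \<and> t \<le> T \<and> x t \<in> frontier (obstacle n r q) \<longrightarrow>
        (\<exists>w. (v \<longlongrightarrow> w) (at_left t) \<and> v t = reflect (sgn (x t - center n q)) w))"


section \<open>Admissibility\<close>

definition visits :: "nat \<Rightarrow> real \<Rightarrow> real \<Rightarrow> (real \<Rightarrow> plane) \<Rightarrow> (int \<times> int) list \<Rightarrow> bool" where
  "visits n r T x \<sigma> \<longleftrightarrow>
     (\<exists>ts. sorted_wrt (<) ts \<and> set ts = collision_times n r T x \<and>
           list_all2 (\<lambda>t q. x t \<in> frontier (obstacle n r q)) ts \<sigma>)"

definition admissible_itinerary :: "nat \<Rightarrow> real \<Rightarrow> (int \<times> int) list \<Rightarrow> bool" where
  "admissible_itinerary n r \<sigma> \<longleftrightarrow>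
     (\<forall>i. i + 1 < length \<sigma> \<longrightarrow>
        \<sigma> ! i \<noteq> \<sigma> ! (i + 1) \<and>
        (\<forall>q. q \<noteq> \<sigma> ! i \<and> q \<noteq> \<sigma> ! (i + 1) \<longrightarrow>
           convex hull (obstacle n r (\<sigma> ! i) \<union> obstacle n r (\<sigma> ! (i + 1)))
             \<inter> obstacle n r q = {})) \<and>
     (\<forall>i. i + 2 < length \<sigma> \<longrightarrow>
        obstacle n r (\<sigma> ! (i + 1))
          \<inter> convex hull (obstacle n r (\<sigma> ! i) \<union> obstacle n r (\<sigma> ! (i + 2))) = {})"

definition admissible :: "nat \<Rightarrow> real \<Rightarrow> real \<Rightarrow> (real \<Rightarrow> plane) \<Rightarrow> bool" where
  "admissible n r T x \<longleftrightarrow> (\<exists>\<sigma>. visits n r T x \<sigma> \<and> admissible_itinerary n r \<sigma>)"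


section \<open>The free group\<close>

text \<open>
  Letters are generators with a sign (\<open>True\<close> for the generator, \<open>False\<close> for its inverse).
  Elements of the free group \<open>F\<^bsub>n+1\<^esub> = \<pi>\<^sub>1(Q\<^sub>n)\<close> are represented by their reduced words, so that the
  element given by an arbitrary word \<open>w\<close> is \<open>free_reduce w\<close>, and \<open>dist(g,1)\<close> is the length of \<open>g\<close>.
\<close>

datatype gen = Gen_a | Gen_b nat

type_synonym letter = "gen \<times> bool"

definition letters :: "nat \<Rightarrow> letter set" where
  "letters n = insert Gen_a (Gen_b ` {1..n}) \<times> UNIV"

definition inv_letter :: "letter \<Rightarrow> letter" where
  "inv_letter l = (fst l, \<not> snd l)"

fun cons_reduce :: "letter \<Rightarrow> letter list \<Rightarrow> letter list" where
  "cons_reduce l [] = [l]"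
| "cons_reduce l (l' # w) = (if l' = inv_letter l then w else l # l' # w)"

definition free_reduce :: "letter list \<Rightarrow> letter list" where
  "free_reduce w = foldr cons_reduce w []"

definition wall_a :: "real \<Rightarrow> plane set" where
  "wall_a r = {0} \<times> {r..1 - r}"

definition wall_b :: "nat \<Rightarrow> real \<Rightarrow> nat \<Rightarrow> plane set" where
  "wall_b n r i = {(real i - 1) / real n + r..real i / real n - r} \<times> {0}"

definition crosses_up :: "(real \<Rightarrow> real) \<Rightarrow> real \<Rightarrow> bool" where
  "crosses_up f t \<longleftrightarrow> (\<forall>\<^sub>F s in at_left t. f s < f t) \<and> (\<forall>\<^sub>F s in at_right t. f t < f s)"

definition crosses_down :: "(real \<Rightarrow> real) \<Rightarrow> real \<Rightarrow> bool" where
  "crosses_down f t \<longleftrightarrow> (\<forall>\<^sub>F s in at_left t. f t < f s) \<and> (\<forall>\<^sub>F s in at_right t. f s < f t)"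

text \<open>
  The lifted curve \<open>x\<close> crosses some lift of a wall at time \<open>t\<close>, contributing the letter \<open>l\<close>.
\<close>

fun wall_crossing :: "nat \<Rightarrow> real \<Rightarrow> (real \<Rightarrow> plane) \<Rightarrow> real \<Rightarrow> letter \<Rightarrow> bool" where
  "wall_crossing n r x t (Gen_a, pos) \<longleftrightarrow>
     (\<exists>p m :: int. x t - (of_int p, of_int m) \<in> wall_a r) \<and>
     (if pos then crosses_up (\<lambda>s. fst (x s)) t else crosses_down (\<lambda>s. fst (x s)) t)"
| "wall_crossing n r x t (Gen_b i, pos) \<longleftrightarrow>
     i \<in> {1..n} \<and>
     (\<exists>p m :: int. x t - (of_int p, of_int m) \<in> wall_b n r i) \<and>
     (if pos then crosses_up (\<lambda>s. snd (x s)) t else crosses_down (\<lambda>s. snd (x s)) t)"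

text \<open>
  Crossings are counted at times strictly between \<open>0\<close> and \<open>T\<close>: an endpoint that lies on a wall is
  joined to the base point on the side of the wall on which the segment itself lies.
\<close>

definition crossing_word ::
    "nat \<Rightarrow> real \<Rightarrow> real \<Rightarrow> (real \<Rightarrow> plane) \<Rightarrow> letter list \<Rightarrow> bool" where
  "crossing_word n r T x w \<longleftrightarrow>
     (\<exists>ts. sorted_wrt (<) ts \<and>
           set ts = {t \<in> {0<..<T}. \<exists>l. wall_crossing n r x t l} \<and>
           list_all2 (wall_crossing n r x) ts w)"

definition pi1_element ::
    "nat \<Rightarrow> real \<Rightarrow> real \<Rightarrow> (real \<Rightarrow> plane) \<Rightarrow> letter list \<Rightarrow> bool" where
  "pi1_element n r T x g \<longleftrightarrow> (\<exists>w. crossing_word n r T x w \<and> g = free_reduce w)"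


section \<open>The cone over the space of ends and the admissible rotation set\<close>

definition ends :: "nat \<Rightarrow> (nat \<Rightarrow> letter) set" where
  "ends n = {e. \<forall>k. e k \<in> letters n \<and> e (Suc k) \<noteq> inv_letter (e k)}"

definition converges_to_end :: "(nat \<Rightarrow> letter list) \<Rightarrow> (nat \<Rightarrow> letter) \<Rightarrow> bool" where
  "converges_to_end g e \<longleftrightarrow> (\<forall>k. \<forall>\<^sub>F m in sequentially. take k (g m) = map e [0..<k])"

definition cone_rel :: "nat \<Rightarrow> ((real \<times> (nat \<Rightarrow> letter)) \<times> (real \<times> (nat \<Rightarrow> letter))) set" where
  "cone_rel n = {(c, d). c \<in> {0..} \<times> ends n \<and> d \<in> {0..} \<times> ends n \<and>
                         (c = d \<or> fst c = 0 \<and> fst d = 0)}"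

lemma equiv_cone_rel: "equiv ({0..} \<times> ends n) (cone_rel n)"
  by (rule equivI) (auto simp: cone_rel_def refl_on_def sym_def trans_def)

definition cone :: "nat \<Rightarrow> (real \<times> (nat \<Rightarrow> letter)) set set" where
  "cone n = ({0..} \<times> ends n) // cone_rel n"

definition cone_point :: "nat \<Rightarrow> real \<Rightarrow> (nat \<Rightarrow> letter) \<Rightarrow> (real \<times> (nat \<Rightarrow> letter)) set" where
  "cone_point n s e = cone_rel n `` {(s, e)}"

lemma cone_eq: "cone n = {cone_point n s e | s e. 0 \<le> s \<and> e \<in> ends n}"
  by (auto simp: cone_def quotient_def cone_point_def)

definition cone_ball :: "nat \<Rightarrow> real \<Rightarrow> (real \<times> (nat \<Rightarrow> letter)) set set" where
  "cone_ball n \<rho> = {cone_point n s e | s e. 0 \<le> s \<and> s \<le> \<rho> \<and> e \<in> ends n}"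

text \<open>For \<open>s = 0\<close> the condition does not depend on \<open>e\<close>, hence is a condition on the vertex.\<close>

definition admissible_rotation_set :: "nat \<Rightarrow> real \<Rightarrow> (real \<times> (nat \<Rightarrow> letter)) set set" where
  "admissible_rotation_set n r =
     {cone_point n s e | s e. 0 \<le> s \<and> e \<in> ends n \<and>
        (\<exists>(T :: nat \<Rightarrow> real) x v g.
           (\<forall>m. billiard_segment n r (T m) (x m) (v m) \<and>
                admissible n r (T m) (x m) \<and>
                pi1_element n r (T m) (x m) (g m)) \<and>
           filterlim T at_top sequentially \<and>
           (\<lambda>m. real (length (g m)) / T m) \<longlonglongrightarrow> s \<and>
           (s > 0 \<longrightarrow> converges_to_end g e))}"

end

theory Submission
  imports Defs
begin

text \<open>
  Membership of \<open>(s, e)\<close> in the admissible rotation set only constrains the limit of \<open>|g\<^sub>m| / T\<^sub>m\<close>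
  and, for each \<open>k\<close>, the first \<open>k\<close> letters of \<open>g\<^sub>m\<close> for large \<open>m\<close>. Hence \<open>g\<^sub>m\<close> may spell the first
  \<open>m\<close> letters of \<open>e\<close> at any pace, as long as the time spent on this is negligible afterwards. The trajectory
  then runs fast for a long time, collecting the letter \<open>b\<^sub>2\<close> over and over, and finally bounces between two
  disks, without collecting anything, until the quotient of word length and time has dropped to \<open>s\<close>
  (lemma \<open>speed_and_prefix_realized\<close>). The fast part zigzags upwards between two neighbouring columns
  of disks; it passes one wall per leg, and the legs are little longer than \<open>1 < \<surd>5\<close>, so every speed up to
  \<open>1/\<surd>5\<close> is within reach.

  Trajectories come from a variational principle. For a sequence of disks, let one point vary in each
  closed disk; by compactness the sum of the distances of consecutive points attains its minimum.
  Suppose that no disk meets the convex hull of its two neighbours in the sequence. Then at a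
  minimizer each point lies on the boundary of its disk, the outer normal there is a positive
  multiple of the sum of the two unit vectors towards the neighbouring points
  (\<open>shortest_detour_normal\<close>), and this is exactly the law of reflection. Suppose also that the hull of two
  consecutive disks meets no third one. Then the polygon is a billiard trajectory that visits
  precisely the given disks (\<open>taut_chain_billiard\<close>).

  All sequences of disks used here, the routes, step from one horizontal row of disks to the next one
  above or below and avoid the disks on the vertical walls. Both hull conditions then reduce to integer
  arithmetic, provided that the three centers of a vertical passage are not collinear
  (\<open>leg_hull_disjoint\<close>, \<open>turn_hull_disjoint\<close>). The crossing word can be read off from the
  labels of the disks, too: a leg crosses the
  vertical walls between the columns of its two disks, transversally and far from its endpoints, and
  a passage of a disk from below to above, or conversely, crosses the horizontal wall on one side of
  that disk. The trajectory passes the disk on the inner side of the bend of the route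
  (\<open>pass_side\<close>), so the integer abscissae of three disks decide which wall it is
  (\<open>taut_chain_crossing_word\<close>).

  It remains to write down, for each letter, a route whose word freely reduces to this letter
  (\<open>letter_route_prepend\<close>), and to concatenate such routes (\<open>word_realized\<close>).
\<close>

section \<open>Shortest chains through balls\<close>

definition chain_length :: "nat \<Rightarrow> (nat \<Rightarrow> 'a::metric_space) \<Rightarrow> real" where
  "chain_length N p = (\<Sum>i<N. dist (p i) (p (Suc i)))"

lemma shortest_chain_exists:
  fixes D :: "nat \<Rightarrow> 'a::metric_space set"
  assumes "\<And>i. compact (D i)" and "\<And>i. D i \<noteq> {}"
  obtains p where "\<And>i. p i \<in> D i"
    and "\<And>q. (\<And>i. q i \<in> D i) \<Longrightarrow> chain_length N p \<le> chain_length N q"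
proof -
  have "compactin (product_topology (\<lambda>i. euclidean) UNIV) (PiE UNIV D)"
    using assms by (simp add: compactin_PiE)
  then have cpt: "compact (PiE UNIV D)"
    by (simp add: euclidean_product_topology)
  have ne: "PiE UNIV D \<noteq> {}"
    using assms by (simp add: PiE_eq_empty_iff)
  have "continuous_on (PiE UNIV D) (chain_length N)"
    unfolding chain_length_def
    by (intro continuous_intros continuous_on_subset[OF continuous_on_product_coordinates]) auto
  from continuous_attains_inf[OF cpt ne this] obtain p
    where p: "p \<in> PiE UNIV D" "\<forall>q\<in>PiE UNIV D. chain_length N p \<le> chain_length N q" by blast
  show thesis
    by (rule that[of p]) (use p in \<open>auto simp: PiE_def Pi_def\<close>)
qed

lemma has_derivative_norm_line:
  fixes a d :: "'a::real_inner"
  assumes "a \<noteq> 0"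
  shows "((\<lambda>t. norm (a + t *\<^sub>R d)) has_real_derivative (sgn a \<bullet> d)) (at 0)"
proof -
  have "((\<lambda>t::real. a + t *\<^sub>R d) has_derivative (\<lambda>t. t *\<^sub>R d)) (at 0)"
    by (auto intro!: derivative_eq_intros)
  moreover have "(norm has_derivative (\<lambda>h. h \<bullet> sgn a)) (at (a + 0 *\<^sub>R d))"
    using has_derivative_norm[of a] assms by (simp add: inner_commute)
  ultimately have "((\<lambda>t::real. norm (a + t *\<^sub>R d)) has_derivative (\<lambda>t. (t *\<^sub>R d) \<bullet> sgn a)) (at 0)"
    by (rule has_derivative_compose)
  moreover have "(\<lambda>t::real. (t *\<^sub>R d) \<bullet> sgn a) = (*) (sgn a \<bullet> d)"
    by (auto simp: inner_commute mult.commute)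
  ultimately show ?thesis
    by (simp add: has_field_derivative_def)
qed

text \<open>
  Moving \<open>C\<close> from its place towards the point of the ball that is extremal in the direction \<open>w\<close>, the sum
  of the two unit vectors towards \<open>A\<close> and \<open>B\<close>, changes the length of the detour at a rate
  given by minus the inner product with \<open>w\<close>. At a minimum this rate is nonnegative, which
  is possible only if \<open>C\<close> is that extremal point already. The vector \<open>w\<close> is nonzero because \<open>C\<close> is not
  on the segment from \<open>A\<close> to \<open>B\<close>. The case \<open>A = B\<close> is the one needed at the ends of a chain.
\<close>
lemma shortest_detour_normal:
  fixes A B C c :: "'a::euclidean_space"
  assumes r: "0 < r" and C: "C \<in> cball c r"
    and min: "\<And>z. z \<in> cball c r \<Longrightarrow> dist A C + dist C B \<le> dist A z + dist z B"
    and disj: "closed_segment A B \<inter> cball c r = {}"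
  obtains \<mu> where "\<mu> > 0" "C - c = \<mu> *\<^sub>R (sgn (A - C) + sgn (B - C))" "norm (C - c) = r"
proof -
  define u1 u2 where "u1 = sgn (A - C)" and "u2 = sgn (B - C)"
  define w where "w = u1 + u2"
  have CAB: "C \<notin> closed_segment A B" using C disj by auto
  then have ne: "A \<noteq> C" "B \<noteq> C" by auto
  have n1: "A - C = norm (A - C) *\<^sub>R u1" "B - C = norm (B - C) *\<^sub>R u2"
    using ne by (auto simp: u1_def u2_def sgn_div_norm)
  have nu: "norm u1 = 1" "norm u2 = 1"
    using ne by (auto simp: u1_def u2_def norm_sgn)
  have w0: "w \<noteq> 0"
  proof
    assume "w = 0"
    then have "u2 = - u1" by (simp add: w_def eq_neg_iff_add_eq_0 add.commute)
    then have "A - B = (norm (A - C) + norm (B - C)) *\<^sub>R u1"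
      using n1 by (simp add: algebra_simps) (metis add_diff_cancel_left' diff_add_cancel diff_diff_eq2)
    then have "dist A B = dist A C + dist C B"
      using nu by (simp add: dist_norm norm_minus_commute)
    then have "between (A, B) C" by (simp add: between)
    then show False using CAB by (simp add: between_mem_segment)
  qed
  define d where "d = c + (r / norm w) *\<^sub>R w - C"
  have "c + (r / norm w) *\<^sub>R w \<in> cball c r"
    using r w0 by (simp add: dist_norm)
  then have in_ball: "C + t *\<^sub>R d \<in> cball c r" if "0 \<le> t" "t \<le> 1" for t
  proof -
    have "C + t *\<^sub>R d = (1 - t) *\<^sub>R C + t *\<^sub>R (c + (r / norm w) *\<^sub>R w)"
      by (simp add: d_def algebra_simps)
    then show ?thesis
      using convexD_alt[OF convex_cball C \<open>c + (r / norm w) *\<^sub>R w \<in> cball c r\<close> that] by simp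
  qed
  have der: "((\<lambda>t. norm ((C - A) + t *\<^sub>R d) + norm ((C - B) + t *\<^sub>R d))
      has_real_derivative (sgn (C - A) \<bullet> d + sgn (C - B) \<bullet> d)) (at 0)"
    using ne by (intro DERIV_add has_derivative_norm_line) auto
  have "sgn (C - A) \<bullet> d + sgn (C - B) \<bullet> d \<ge> 0"
  proof (rule ccontr)
    assume "\<not> ?thesis"
    then obtain \<epsilon> where e: "\<epsilon> > 0" and dec: "\<forall>h>0. h < \<epsilon> \<longrightarrow>
        norm ((C - A) + (0 + h) *\<^sub>R d) + norm ((C - B) + (0 + h) *\<^sub>R d)
          < norm ((C - A) + 0 *\<^sub>R d) + norm ((C - B) + 0 *\<^sub>R d)"
      using DERIV_neg_dec_right[OF der] by auto
    define h where "h = min 1 (\<epsilon> / 2)"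
    have h: "0 < h" "h < \<epsilon>" "h \<le> 1" using e by (auto simp: h_def)
    have "dist A (C + h *\<^sub>R d) + dist (C + h *\<^sub>R d) B < dist A C + dist C B"
      using dec h by (simp add: dist_norm norm_minus_commute algebra_simps)
    then show False using min[OF in_ball[of h]] h by simp
  qed
  moreover have "sgn (C - A) = - u1" "sgn (C - B) = - u2"
    using sgn_minus[of "A - C"] sgn_minus[of "B - C"] by (auto simp: u1_def u2_def)
  ultimately have "w \<bullet> d \<le> 0"
    by (simp add: w_def inner_add_left)
  then have "r * norm w \<le> w \<bullet> (C - c)"
    using w0 by (simp add: d_def inner_diff_right inner_add_right power2_norm_eq_inner[symmetric]
        power2_eq_square)
  moreover have "w \<bullet> (C - c) \<le> norm w * norm (C - c)" by (rule norm_cauchy_schwarz)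
  moreover have Cr: "norm (C - c) \<le> r" using C by (simp add: dist_norm norm_minus_commute)
  moreover have "norm w * norm (C - c) \<le> norm w * r" using Cr by (simp add: mult_left_mono)
  ultimately have eq: "w \<bullet> (C - c) = norm w * norm (C - c)" "norm w * norm (C - c) = norm w * r"
    by (simp_all only: mult.commute[of r])
  have nr: "norm (C - c) = r" using eq(2) w0 by simp
  have "norm w *\<^sub>R (C - c) = r *\<^sub>R w"
    using eq(1) norm_cauchy_schwarz_eq[of w "C - c"] nr by simp
  then have "C - c = (r / norm w) *\<^sub>R w"
    using w0 by (metis divide_inverse_commute left_inverse norm_eq_zero scaleR_one scaleR_scaleR)
  then show thesis
    using that[of "r / norm w"] nr r w0 by (simp add: w_def u1_def u2_def)
qed

text \<open>The sum of two unit vectors bisects their angle, so reflection in the line orthogonal to it turns the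
  reversed first one, the incoming velocity, into the second one.\<close>
lemma reflect_bisector:
  assumes "norm u1 = 1" "norm u2 = 1" "u1 + u2 \<noteq> 0"
  shows "reflect (sgn (u1 + u2)) (- u1) = u2"
proof -
  define w where "w = u1 + u2"
  have "u1 \<bullet> u1 = 1" "u2 \<bullet> u2 = 1"
    using assms by (simp_all add: power2_norm_eq_inner[symmetric])
  then have "w \<bullet> w = 2 * (u1 \<bullet> w)"
    by (simp add: w_def inner_add_left inner_add_right inner_commute)
  moreover have w0: "norm w * norm w \<noteq> 0" using assms(3) by (simp add: w_def)
  moreover have "w \<bullet> w = norm w * norm w"
    by (simp add: power2_norm_eq_inner[symmetric] power2_eq_square)
  ultimately have "2 * (u1 \<bullet> w) / (norm w * norm w) = 1"
    by (metis divide_self)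
  then have "(2 * (u1 \<bullet> sgn w)) *\<^sub>R sgn w = w"
    by (simp add: sgn_div_norm divide_inverse mult.assoc) (metis mult.assoc mult.commute scaleR_one)
  then have "reflect (sgn w) (- u1) = - u1 + w"
    unfolding reflect_def by simp
  then show ?thesis by (simp add: w_def)
qed

text \<open>The outgoing direction has a nonnegative inner product with the outer normal, by
  the bisector property of the normal; hence the distance to the center increases strictly along it.\<close>
lemma shortest_detour_leaves_ball:
  fixes A B C c :: "'a::real_inner"
  assumes "\<mu> > 0" "C - c = \<mu> *\<^sub>R (sgn (A - C) + sgn (B - C))" "norm (C - c) = r"
    and "B \<noteq> C" "0 < \<theta>"
  shows "C + \<theta> *\<^sub>R (B - C) \<notin> cball c r"
proof -
  let ?u = "sgn (A - C)" and ?v = "sgn (B - C)"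
  have v: "norm ?v = 1" "B - C = norm (B - C) *\<^sub>R ?v"
    using assms(4) by (auto simp: norm_sgn sgn_div_norm)
  have "\<bar>?u \<bullet> ?v\<bar> \<le> norm ?u * norm ?v" by (rule Cauchy_Schwarz_ineq2)
  also have "\<dots> \<le> 1" by (simp add: norm_sgn)
  finally have uv: "?u \<bullet> ?v \<ge> -1" by simp
  have "(C - c) \<bullet> (B - C) = \<mu> * norm (B - C) * (?u \<bullet> ?v + ?v \<bullet> ?v)"
    using assms(2) v(2) by (metis inner_add_left inner_scaleR_left inner_scaleR_right mult.assoc mult.commute)
  also have "?v \<bullet> ?v = 1" using v(1) by (simp add: power2_norm_eq_inner[symmetric])
  finally have ge: "(C - c) \<bullet> (B - C) \<ge> 0"
    using uv assms(1) by simp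
  have "(norm (C + \<theta> *\<^sub>R (B - C) - c))\<^sup>2 = (norm ((C - c) + \<theta> *\<^sub>R (B - C)))\<^sup>2"
    by (simp add: algebra_simps)
  also have "\<dots> = r\<^sup>2 + 2 * \<theta> * ((C - c) \<bullet> (B - C)) + \<theta>\<^sup>2 * (norm (B - C))\<^sup>2"
    unfolding assms(3)[symmetric]
    by (simp add: power2_norm_eq_inner inner_add_left inner_add_right inner_commute
        power2_eq_square[of \<theta>])
  also have "\<dots> > r\<^sup>2"
  proof -
    have "\<theta>\<^sup>2 * (norm (B - C))\<^sup>2 > 0" using assms by simp
    moreover have "2 * \<theta> * ((C - c) \<bullet> (B - C)) \<ge> 0" using ge assms by simp
    ultimately show ?thesis by linarith
  qed
  finally have "norm (C + \<theta> *\<^sub>R (B - C) - c) > r"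
    using assms(3) by (metis norm_ge_zero power2_less_imp_less)
  then show ?thesis by (simp add: dist_norm norm_minus_commute)
qed

section \<open>Polygons that obey the law of reflection\<close>

lemma chain_length_Suc [simp]:
  "chain_length (Suc i) p = chain_length i p + dist (p i) (p (Suc i))"
  by (simp add: chain_length_def)

lemma chain_length_0 [simp]: "chain_length 0 p = 0"
  by (simp add: chain_length_def)

lemma chain_length_mono: "i \<le> j \<Longrightarrow> chain_length i p \<le> chain_length j p"
  by (rule lift_Suc_mono_le[of "\<lambda>i. chain_length i p"]) auto

lemma chain_length_nonneg: "0 \<le> chain_length N p"
  using chain_length_mono[of 0 N p] by simp

lemma chain_length_ge:
  assumes "\<And>i. i < N \<Longrightarrow> c \<le> dist (p i) (p (Suc i))"
  shows "real N * c \<le> chain_length N p"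
  unfolding chain_length_def using assms sum_bounded_below[of "{..<N}" c] by simp

lemma chain_length_le:
  assumes "\<And>i. i < N \<Longrightarrow> dist (p i) (p (Suc i)) \<le> c"
  shows "chain_length N p \<le> real N * c"
  unfolding chain_length_def using assms sum_bounded_above[of "{..<N}" _ c] by simp

lemma dist_plane_le: "dist (P::plane) Q \<le> \<bar>fst P - fst Q\<bar> + \<bar>snd P - snd Q\<bar>"
  unfolding dist_prod_def dist_real_def by (rule sqrt_sum_squares_le_sum) auto

lemma chain_length_cover:
  assumes "0 \<le> t" "t < chain_length N p"
  shows "\<exists>i<N. chain_length i p \<le> t \<and> t < chain_length (Suc i) p"
  using assms
proof (induction N)
  case (Suc N)
  show ?case
  proof (cases "t < chain_length N p")
    case True
    then show ?thesis using Suc.IH[OF Suc.prems(1)] less_SucI by blast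
  next
    case False
    then show ?thesis using Suc.prems by (intro exI[of _ N]) simp
  qed
qed simp

text \<open>
  The polygon with vertices \<open>p 0, \<dots>, p N\<close>, run through with unit speed. The point \<open>p (Suc N)\<close> lies beyond
  the end of the trajectory: its direction from \<open>p N\<close> is the outgoing velocity at the last collision,
  which the reflection law demands although the trajectory stops there.
\<close>
lemma polygon_billiard_segment:
  fixes p :: "nat \<Rightarrow> plane"
  assumes r: "0 < r"
    and on: "\<And>i. i \<le> N \<Longrightarrow> dist (center n (\<sigma> i)) (p i) = r"
    and own: "\<And>i q. i \<le> N \<Longrightarrow> dist (center n q) (p i) \<le> r \<Longrightarrow> q = \<sigma> i"
    and free: "\<And>i q \<theta>. i < N \<Longrightarrow> 0 < \<theta> \<Longrightarrow> \<theta> < 1 \<Longrightarrow>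
                 p i + \<theta> *\<^sub>R (p (Suc i) - p i) \<notin> cball (center n q) r"
    and ne: "\<And>i. i \<le> N \<Longrightarrow> p (Suc i) \<noteq> p i"
    and law: "\<And>i. i < N \<Longrightarrow> sgn (p (Suc (Suc i)) - p (Suc i)) =
                 reflect (sgn (p (Suc i) - center n (\<sigma> (Suc i)))) (sgn (p (Suc i) - p i))"
  obtains x v where "billiard_segment n r (chain_length N p) x v"
    and "\<And>i t. i < N \<Longrightarrow> chain_length i p \<le> t \<Longrightarrow> t \<le> chain_length (Suc i) p \<Longrightarrow>
           x t = p i + (t - chain_length i p) *\<^sub>R sgn (p (Suc i) - p i)"
    and "visits n r (chain_length N p) x (map \<sigma> [0..<Suc N])"
proof -
  define \<tau> where "\<tau> i = chain_length i p" for i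
  define u where "u i = sgn (p (Suc i) - p i)" for i
  \<comment> \<open>the index of the leg at time \<open>t\<close>; at a collision, that of the leg which starts there\<close>
  define k where "k t = card {m \<in> {1..N}. \<tau> m \<le> t}" for t
  define x where "x t = p (k t) + (t - \<tau> (k t)) *\<^sub>R u (k t)" for t
  define v where "v t = u (k t)" for t
  have mono: "\<tau> i \<le> \<tau> j" if "i \<le> j" for i j
    using that by (simp add: \<tau>_def chain_length_mono)
  have step: "\<tau> i < \<tau> (Suc i)" if "i \<le> N" for i
    using ne[OF that] by (simp add: \<tau>_def dist_commute)
  have \<tau>0: "\<tau> 0 = 0" by (simp add: \<tau>_def)
  have strict: "\<tau> i < \<tau> j" if "i < j" "j \<le> N" for i j
    using step[of i] mono[of "Suc i" j] that by simp
  have nu: "norm (u i) = 1" if "i \<le> N" for i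
    using ne[OF that] by (simp add: u_def norm_sgn)
  have pSuc: "p (Suc i) = p i + (\<tau> (Suc i) - \<tau> i) *\<^sub>R u i" if "i \<le> N" for i
    using ne[OF that] by (simp add: u_def \<tau>_def sgn_div_norm dist_norm norm_minus_commute)
  have k_leg: "k t = i" if "i < N" "\<tau> i \<le> t" "t < \<tau> (Suc i)" for i t
  proof -
    have "{m \<in> {1..N}. \<tau> m \<le> t} = {1..i}"
    proof (intro set_eqI iffI)
      fix m assume m: "m \<in> {m \<in> {1..N}. \<tau> m \<le> t}"
      have "\<not> Suc i \<le> m" using mono[of "Suc i" m] m that by auto
      then show "m \<in> {1..i}" using m by auto
    next
      fix m assume m: "m \<in> {1..i}"
      then show "m \<in> {m \<in> {1..N}. \<tau> m \<le> t}" using mono[of m i] that by auto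
    qed
    then show ?thesis by (simp add: k_def)
  qed
  have k_end: "k t = N" if "\<tau> N \<le> t" for t
  proof -
    have "{m \<in> {1..N}. \<tau> m \<le> t} = {1..N}"
      using mono[of _ N] that by force
    then show ?thesis by (simp add: k_def)
  qed
  have k_\<tau>: "k (\<tau> i) = i" if "i \<le> N" for i
  proof (cases "i = N")
    case False then show ?thesis using k_leg[of i "\<tau> i"] step[of i] that by simp
  qed (simp add: k_end)
  have x_\<tau>: "x (\<tau> i) = p i" if "i \<le> N" for i
    using k_\<tau>[OF that] by (simp add: x_def)
  have x_leg: "x t = p i + (t - \<tau> i) *\<^sub>R u i" if "i < N" "\<tau> i \<le> t" "t \<le> \<tau> (Suc i)" for i t
  proof (cases "t = \<tau> (Suc i)")
    case True then show ?thesis using x_\<tau>[of "Suc i"] that pSuc[of i] by simp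
  next
    case False then show ?thesis using k_leg[of i t] that by (simp add: x_def)
  qed
  have cover: "t = \<tau> N \<or> (\<exists>i<N. \<tau> i \<le> t \<and> t < \<tau> (Suc i))" if "0 \<le> t" "t \<le> \<tau> N" for t
    using chain_length_cover[of t N p] that unfolding \<tau>_def
    by (cases "t < chain_length N p") (blast, simp)
  have inside: "x t \<notin> cball (center n q) r" if "i < N" "\<tau> i < t" "t < \<tau> (Suc i)" for i t q
  proof -
    define \<theta> where "\<theta> = (t - \<tau> i) / (\<tau> (Suc i) - \<tau> i)"
    have "0 < \<theta>" "\<theta> < 1" using that by (auto simp: \<theta>_def)
    moreover have "x t = p i + \<theta> *\<^sub>R (p (Suc i) - p i)"
      using x_leg[of i t] pSuc[of i] that by (simp add: \<theta>_def)
    ultimately show ?thesis using free[of i \<theta> q] that by simp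
  qed
  have front: "frontier (obstacle n r q) = sphere (center n q) r" for q
    using r by (simp add: obstacle_def)
  have hit: "\<exists>i\<le>N. t = \<tau> i \<and> q = \<sigma> i"
    if t: "0 \<le> t" "t \<le> \<tau> N" and c: "x t \<in> cball (center n q) r" for t q
  proof -
    have "\<exists>i\<le>N. t = \<tau> i"
      using cover[OF t]
    proof
      assume "\<exists>i<N. \<tau> i \<le> t \<and> t < \<tau> (Suc i)"
      then obtain i where i: "i < N" "\<tau> i \<le> t" "t < \<tau> (Suc i)" by blast
      moreover have "\<not> \<tau> i < t" using inside[of i t q] c i by blast
      ultimately have "t = \<tau> i" by simp
      then show ?thesis using i(1) by (intro exI[of _ i]) simp
    qed blast
    then obtain i where i: "i \<le> N" "t = \<tau> i" by blast
    then have "dist (center n q) (p i) \<le> r" using c x_\<tau>[of i] by simp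
    then show ?thesis using own[of i q] i by blast
  qed
  have coll: "collision_times n r (\<tau> N) x = \<tau> ` {..N}"
  proof (intro set_eqI iffI)
    fix t assume "t \<in> collision_times n r (\<tau> N) x"
    then obtain q where "0 \<le> t" "t \<le> \<tau> N" "x t \<in> sphere (center n q) r"
      by (auto simp: collision_times_def front)
    then show "t \<in> \<tau> ` {..N}" using hit[of t q] by auto
  next
    fix t assume "t \<in> \<tau> ` {..N}"
    then obtain i where i: "i \<le> N" "t = \<tau> i" by auto
    then have "x t \<in> frontier (obstacle n r (\<sigma> i))" using on[of i] x_\<tau>[of i] front by simp
    then show "t \<in> collision_times n r (\<tau> N) x"
      using i mono[of 0 i] mono[of i N] \<tau>0 unfolding collision_times_def
      by (intro CollectI conjI exI[of _ "\<sigma> i"]) auto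
  qed
  have "billiard_segment n r (\<tau> N) x v"
    unfolding billiard_segment_def
  proof (intro conjI ballI allI impI)
    show "0 \<le> \<tau> N" using mono[of 0 N] \<tau>0 by simp
    show "finite (collision_times n r (\<tau> N) x)" by (simp add: coll)
  next
    fix t assume t: "t \<in> {0..\<tau> N}"
    show "x t \<in> table n r"
    proof (rule ccontr)
      assume "x t \<notin> table n r"
      then obtain q where q: "dist (center n q) (x t) < r"
        by (auto simp: table_def obstacle_def)
      then obtain i where "i \<le> N" "t = \<tau> i" "q = \<sigma> i" using hit[of t q] t by auto
      then show False using on[of i] x_\<tau>[of i] q by simp
    qed
    show "norm (v t) = 1"
      using cover[of t] t nu k_end[of t] k_leg[of _ t] by (auto simp: v_def)
  next
    fix s t assume st: "0 \<le> s \<and> s < t \<and> t \<le> \<tau> N \<and> {s<..<t} \<inter> collision_times n r (\<tau> N) x = {}"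
    then obtain i where i: "i < N" "\<tau> i \<le> s" "s < \<tau> (Suc i)" using cover[of s] by auto
    have "\<tau> (Suc i) \<in> collision_times n r (\<tau> N) x" using i by (auto simp: coll)
    then have tle: "t \<le> \<tau> (Suc i)" using st i by (meson disjoint_iff greaterThanLessThan_iff not_le)
    have vs: "v s = u i" using k_leg[OF i] by (simp add: v_def)
    have "(t - \<tau> i) *\<^sub>R u i = (s - \<tau> i) *\<^sub>R u i + (t - s) *\<^sub>R u i"
      by (simp flip: scaleR_left_distrib)
    then show "x t = x s + (t - s) *\<^sub>R v s"
      using x_leg[of i t] x_leg[of i s] tle i st vs by simp
    assume "t \<notin> collision_times n r (\<tau> N) x"
    then have "t \<noteq> \<tau> (Suc i)" using i by (auto simp: coll)
    then show "v t = v s" using k_leg[of i t] tle i st vs by (simp add: v_def)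
  next
    fix t q assume t: "0 < t \<and> t \<le> \<tau> N \<and> x t \<in> frontier (obstacle n r q)"
    then obtain i where i: "i \<le> N" "t = \<tau> i" "q = \<sigma> i" using hit[of t q] by (auto simp: front)
    then obtain m where m: "i = Suc m" using t \<tau>0 by (cases i) auto
    have "\<forall>\<^sub>F s in at_left t. s \<in> {\<tau> m<..<t}"
      using eventually_at_left_real[of "\<tau> m" t] strict[of m i] i m by simp
    then have "\<forall>\<^sub>F s in at_left t. v s = u m"
      by eventually_elim (use i m k_leg[of m] in \<open>auto simp: v_def\<close>)
    then have "(v \<longlongrightarrow> u m) (at_left t)" by (rule tendsto_eventually)
    moreover have "v t = reflect (sgn (x t - center n q)) (u m)"
      using law[of m] k_\<tau>[of i] x_\<tau>[of i] i m by (simp add: v_def u_def)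
    ultimately show "\<exists>w. (v \<longlongrightarrow> w) (at_left t) \<and> v t = reflect (sgn (x t - center n q)) w"
      by blast
  qed
  moreover have "visits n r (\<tau> N) x (map \<sigma> [0..<Suc N])"
    unfolding visits_def
  proof (intro exI[of _ "map \<tau> [0..<Suc N]"] conjI)
    show "sorted_wrt (<) (map \<tau> [0..<Suc N])"
      using strict by (simp add: sorted_wrt_iff_nth_less del: upt_Suc)
    show "set (map \<tau> [0..<Suc N]) = collision_times n r (\<tau> N) x"
      unfolding coll by (simp only: set_map set_upt atLeast0LessThan lessThan_Suc_atMost)
    show "list_all2 (\<lambda>t q. x t \<in> frontier (obstacle n r q)) (map \<tau> [0..<Suc N]) (map \<sigma> [0..<Suc N])"
      using on x_\<tau> by (simp add: list_all2_conv_all_nth front del: upt_Suc)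
  qed
  ultimately show thesis
    using that[of x v] x_leg unfolding \<tau>_def u_def by blast
qed

section \<open>Legs and turns between small disks\<close>

lemma halfplane_separates_balls:
  fixes \<nu> :: "'a::real_inner"
  assumes "\<nu> \<bullet> c\<^sub>0 \<le> \<beta>" "\<nu> \<bullet> c\<^sub>1 \<le> \<beta>" "\<nu> \<bullet> c\<^sub>2 > \<beta> + 2 * r * norm \<nu>"
  shows "convex hull (cball c\<^sub>0 r \<union> cball c\<^sub>1 r) \<inter> cball c\<^sub>2 r = {}"
proof -
  have ball: "\<bar>\<nu> \<bullet> z - \<nu> \<bullet> c\<bar> \<le> r * norm \<nu>" if "z \<in> cball c r" for z c
  proof -
    have "\<bar>\<nu> \<bullet> z - \<nu> \<bullet> c\<bar> \<le> norm \<nu> * norm (z - c)"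
      using Cauchy_Schwarz_ineq2[of \<nu> "z - c"] by (simp add: inner_diff_right)
    also have "\<dots> \<le> norm \<nu> * r"
      using that by (intro mult_left_mono) (auto simp: dist_norm norm_minus_commute)
    finally show ?thesis by (simp add: mult.commute)
  qed
  have "convex hull (cball c\<^sub>0 r \<union> cball c\<^sub>1 r) \<subseteq> {z. \<nu> \<bullet> z \<le> \<beta> + r * norm \<nu>}"
  proof (rule hull_minimal)
    show "cball c\<^sub>0 r \<union> cball c\<^sub>1 r \<subseteq> {z. \<nu> \<bullet> z \<le> \<beta> + r * norm \<nu>}"
      using ball[of _ c\<^sub>0] ball[of _ c\<^sub>1] assms by fastforce
  qed (rule convex_halfspace_le)
  moreover have "\<nu> \<bullet> z > \<beta> + r * norm \<nu>" if "z \<in> cball c\<^sub>2 r" for z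
    using ball[OF that] assms by linarith
  ultimately show ?thesis by force
qed

lemma line_separates_balls:
  fixes \<nu> :: "'a::real_inner"
  assumes "\<nu> \<bullet> c\<^sub>1 = \<nu> \<bullet> c\<^sub>0" "\<bar>\<nu> \<bullet> c\<^sub>2 - \<nu> \<bullet> c\<^sub>0\<bar> > 2 * r * norm \<nu>"
  shows "convex hull (cball c\<^sub>0 r \<union> cball c\<^sub>1 r) \<inter> cball c\<^sub>2 r = {}"
proof (cases "\<nu> \<bullet> c\<^sub>2 > \<nu> \<bullet> c\<^sub>0")
  case True
  then show ?thesis using assms by (intro halfplane_separates_balls[of \<nu> _ "\<nu> \<bullet> c\<^sub>0"]) auto
next
  case False
  then show ?thesis
    using assms by (intro halfplane_separates_balls[of "- \<nu>" _ "- (\<nu> \<bullet> c\<^sub>0)"]) auto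
qed

text \<open>
  The bound on \<open>r\<close> makes the disks small even in comparison with the distance \<open>1/n\<close> of neighbouring
  centers, which is the scale of every gap that occurs below.
\<close>
locale small_disks =
  fixes n :: nat and r :: real
  assumes n3: "3 \<le> n" and r_pos: "0 < r" and r_small: "100 * real n * r < 1"
begin

text \<open>
  The labels \<open>(j, k)\<close> with \<open>n dvd j\<close> are those of the disks on the vertical walls, which routes
  avoid. A leg joins consecutive rows and crosses at most one vertical wall. Its slope is at least \<open>1/2\<close>
  in absolute value, so that it passes the other disks of the rows of its ends at a distance of
  order \<open>1/n\<close>.
\<close>
definition leg :: "int \<times> int \<Rightarrow> int \<times> int \<Rightarrow> bool" where
  "leg q q' \<longleftrightarrow> \<not> int n dvd fst q \<and> \<not> int n dvd fst q' \<and>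
     \<bar>fst q' - fst q\<bar> \<le> 2 * int n \<and> \<bar>fst q' div int n - fst q div int n\<bar> \<le> 1 \<and>
     \<bar>snd q' - snd q\<bar> = 1"

text \<open>
  If the route bounces back to the row from which it came, the hull of the outer disks stays in that row.
  If it passes on to the next row, it needs a bend, since the line through three collinear centers would
  meet the middle disk.
\<close>
definition turn :: "int \<times> int \<Rightarrow> int \<times> int \<Rightarrow> int \<times> int \<Rightarrow> bool" where
  "turn q q' q'' \<longleftrightarrow> snd q = snd q'' \<or> fst q + fst q'' \<noteq> 2 * fst q'"

abbreviation disk :: "int \<times> int \<Rightarrow> plane set" where
  "disk q \<equiv> cball (center n q) r"

lemma n_pos: "real n > 0" using n3 by simp

lemma r_less: "r < 1 / (100 * real n)"
  using r_small n_pos by (simp add: field_simps)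

lemma r_less_300th: "300 * r < 1"
proof -
  have "3 * r \<le> real n * r" using n3 r_pos by (intro mult_right_mono) auto
  then show ?thesis using r_small by linarith
qed

lemma r_small_12: "12 * r < 1 / real n"
proof -
  have "0 < real n * r" using n_pos r_pos by simp
  then have "12 * r * real n < 1" using r_small by (simp add: mult.commute mult.left_commute)
  then show ?thesis using n_pos by (simp add: pos_less_divide_eq)
qed

lemma leg_commute: "leg q q' \<longleftrightarrow> leg q' q"
  by (auto simp: leg_def abs_minus_commute)

lemma leg_cases:
  assumes "leg q q'"
  obtains \<epsilon> where "snd q' = snd q + \<epsilon>" "\<epsilon> = 1 \<or> \<epsilon> = -1" "\<epsilon> * \<epsilon> = 1"
proof -
  have "\<bar>snd q' - snd q\<bar> = 1" using assms by (simp add: leg_def)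
  then consider "snd q' - snd q = 1" | "snd q' - snd q = -1" by linarith
  then show thesis using that[of "snd q' - snd q"] by cases auto
qed

lemma int_div_n_ge:
  assumes "m \<noteq> (0::int)"
  shows "\<bar>of_int m / real n\<bar> \<ge> 1 / real n"
proof -
  have "\<bar>m\<bar> \<ge> 1" using assms by simp
  then have "\<bar>of_int m :: real\<bar> \<ge> 1" by linarith
  then show ?thesis using n_pos by (simp add: divide_right_mono)
qed

lemma centers_apart:
  assumes "q \<noteq> q'"
  shows "dist (center n q) (center n q') \<ge> 1 / real n"
proof (cases "fst q = fst q'")
  case False
  then have "\<bar>of_int (fst q - fst q') / real n\<bar> \<ge> 1 / real n" by (intro int_div_n_ge) simp
  also have "of_int (fst q - fst q') / real n = fst (center n q) - fst (center n q')"
    by (simp add: center_def diff_divide_distrib)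
  also have "\<bar>\<dots>\<bar> \<le> dist (center n q) (center n q')"
    using dist_fst_le[of "center n q" "center n q'"] by (simp add: dist_real_def)
  finally show ?thesis .
next
  case True
  then have "snd q - snd q' \<noteq> 0" using assms by (simp add: prod_eq_iff)
  then have "\<bar>snd q - snd q'\<bar> \<ge> 1" by linarith
  then have "\<bar>of_int (snd q) - of_int (snd q') :: real\<bar> \<ge> 1" by linarith
  moreover have "\<bar>of_int (snd q) - of_int (snd q') :: real\<bar> \<le> dist (center n q) (center n q')"
    using dist_snd_le[of "center n q" "center n q'"] by (simp add: dist_real_def center_def)
  moreover have "1 / real n \<le> 1" using n3 by simp
  ultimately show ?thesis by linarith
qed

lemma inner_center: "(a, b) \<bullet> center n q = a * (of_int (fst q) / real n) + b * of_int (snd q)"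
  by (simp add: center_def inner_prod_def)

text \<open>
  For a third disk in the row of \<open>q\<close> or of \<open>q'\<close> a line parallel to the one through the
  two centers separates; for the other rows a horizontal line does.
\<close>
lemma leg_hull_disjoint:
  assumes leg: "leg q q'" and ne: "p \<noteq> q" "p \<noteq> q'"
  shows "convex hull (disk q \<union> disk q') \<inter> disk p = {}"
proof -
  obtain \<epsilon> where e: "snd q' = snd q + \<epsilon>" "\<epsilon> = 1 \<or> \<epsilon> = -1" "\<epsilon> * \<epsilon> = 1"
    by (rule leg_cases[OF leg])
  show ?thesis
  proof (cases "snd p = snd q \<or> snd p = snd q'")
    case True
    define d where "d = of_int (fst q' - fst q) / real n"
    define \<nu> :: plane where "\<nu> = (1, - d * of_int \<epsilon>)"
    have e2: "of_int \<epsilon> * of_int \<epsilon> = (1::real)" using e(3) by (metis of_int_1 of_int_mult)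
    have "\<bar>fst q' - fst q\<bar> \<le> 2 * int n" using leg by (simp add: leg_def)
    then have "\<bar>of_int (fst q' - fst q)\<bar> \<le> 2 * real n" by linarith
    then have "\<bar>d\<bar> \<le> 2" using n_pos by (simp add: d_def field_simps)
    then have "norm \<nu> \<le> 1 + 2"
      unfolding \<nu>_def using norm_Pair_le[of "1::real" "- d * of_int \<epsilon>"] e(2) by auto
    then have "2 * r * norm \<nu> \<le> 2 * r * 3" using r_pos by (intro mult_left_mono) auto
    then have small: "2 * r * norm \<nu> < 1 / real n"
      using r_small_12 r_pos by linarith
    have eq: "\<nu> \<bullet> center n q' = \<nu> \<bullet> center n q"
      using e2 by (simp add: \<nu>_def inner_center e(1) algebra_simps)
        (simp add: d_def diff_divide_distrib)
    have "\<bar>\<nu> \<bullet> center n p - \<nu> \<bullet> center n q\<bar> \<ge> 1 / real n"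
    proof (cases "snd p = snd q")
      case True
      then have "fst p - fst q \<noteq> 0" using ne by (simp add: prod_eq_iff)
      from int_div_n_ge[OF this] show ?thesis
        using True by (simp add: \<nu>_def inner_center diff_divide_distrib)
    next
      case False
      with True have s: "snd p = snd q'" by simp
      then have "fst p - fst q' \<noteq> 0" using ne by (simp add: prod_eq_iff)
      from int_div_n_ge[OF this] show ?thesis
        using s unfolding eq[symmetric] by (simp add: \<nu>_def inner_center diff_divide_distrib)
    qed
    then show ?thesis using small eq by (intro line_separates_balls[of \<nu>]) auto
  next
    case False
    have r2: "2 * r < 1" using r_less_300th r_pos by simp
    show ?thesis
    proof (cases "snd p > max (snd q) (snd q')")
      case True
      then have "real_of_int (snd p) \<ge> max (of_int (snd q)) (of_int (snd q')) + 1" by linarith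
      then show ?thesis
        using r2 by (intro halfplane_separates_balls[of "(0,1)" _ "max (of_int (snd q)) (of_int (snd q'))"])
          (auto simp: inner_center)
    next
      case nless: False
      then have "snd p < min (snd q) (snd q')" using False e(1,2) by auto
      then have "- real_of_int (snd p) \<ge> - min (of_int (snd q)) (of_int (snd q')) + 1" by linarith
      then show ?thesis
        using r2 by (intro halfplane_separates_balls[of "(0,-1)" _ "- min (of_int (snd q)) (of_int (snd q'))"])
          (auto simp: inner_center)
    qed
  qed
qed

text \<open>
  The integer \<open>2 * fst q' - fst q - fst q''\<close> measures how far the middle center is from the line
  through the other two, in units of \<open>1/n\<close>; it is nonzero at a bend.
\<close>
lemma turn_hull_disjoint:
  assumes leg1: "leg q q'" and leg2: "leg q' q''" and turn: "turn q q' q''"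
  shows "convex hull (disk q \<union> disk q'') \<inter> disk q' = {}"
proof -
  obtain \<epsilon> where e: "snd q' = snd q + \<epsilon>" "\<epsilon> = 1 \<or> \<epsilon> = -1" "\<epsilon> * \<epsilon> = 1"
    by (rule leg_cases[OF leg1])
  have e2: "of_int \<epsilon> * of_int \<epsilon> = (1::real)" using e(3) by (metis of_int_1 of_int_mult)
  show ?thesis
  proof (cases "snd q = snd q''")
    case True
    have "2 * r * norm (0::real, of_int \<epsilon> :: real) < 1" using e(2) r_less_300th r_pos by auto
    then show ?thesis using True e(1) e2
      by (intro line_separates_balls[of "(0, of_int \<epsilon>)"]) (auto simp: inner_center algebra_simps)
  next
    case False
    have s: "snd q'' = snd q' + \<epsilon>"
      using leg2 False e(1,2) by (auto simp: leg_def abs_if split: if_splits)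
    have ne: "2 * fst q' - fst q - fst q'' \<noteq> 0" using turn False by (auto simp: turn_def)
    define d where "d = of_int (fst q'' - fst q) / real n"
    define \<nu> :: plane where "\<nu> = (2, - d * of_int \<epsilon>)"
    have "\<bar>fst q'' - fst q\<bar> \<le> 4 * int n" using leg1 leg2 unfolding leg_def by linarith
    then have "\<bar>of_int (fst q'' - fst q)\<bar> \<le> 4 * real n" by linarith
    then have "\<bar>d\<bar> \<le> 4" using n_pos by (simp add: d_def field_simps)
    then have "norm \<nu> \<le> 2 + 4"
      unfolding \<nu>_def using norm_Pair_le[of "2::real" "- d * of_int \<epsilon>"] e(2) by auto
    then have "2 * r * norm \<nu> \<le> 2 * r * 6" using r_pos by (intro mult_left_mono) auto
    then have small: "2 * r * norm \<nu> < 1 / real n"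
      using r_small_12 r_pos by linarith
    have eq: "\<nu> \<bullet> center n q'' = \<nu> \<bullet> center n q"
      using e(2) by (elim disjE)
        (simp_all add: \<nu>_def inner_center e(1) s d_def diff_divide_distrib algebra_simps)
    have "\<nu> \<bullet> center n q' - \<nu> \<bullet> center n q = of_int (2 * fst q' - fst q - fst q'') / real n"
      using e2 by (simp add: \<nu>_def inner_center e(1) algebra_simps)
        (simp add: d_def diff_divide_distrib add_divide_distrib)
    then have "\<bar>\<nu> \<bullet> center n q' - \<nu> \<bullet> center n q\<bar> \<ge> 1 / real n"
      using int_div_n_ge[OF ne] by simp
    then show ?thesis using small eq by (intro line_separates_balls[of \<nu>]) auto
  qed
qed

end

lemma chain_length_cong:
  "(\<And>i. i \<le> N \<Longrightarrow> p i = q i) \<Longrightarrow> chain_length N p = chain_length N q"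
  unfolding chain_length_def by (intro sum.cong) auto

lemma chain_length_update_inner:
  assumes "Suc m < N"
  shows "chain_length N (p(Suc m := z)) + dist (p m) (p (Suc m)) + dist (p (Suc m)) (p (Suc (Suc m)))
       = chain_length N p + dist (p m) z + dist z (p (Suc (Suc m)))"
  using assms
proof (induction N)
  case (Suc N)
  show ?case
  proof (cases "Suc m < N")
    case True
    then show ?thesis using Suc.IH by simp
  next
    case False
    with Suc.prems have "N = Suc m" by simp
    moreover have "chain_length m (p(Suc m := z)) = chain_length m p"
      by (rule chain_length_cong) auto
    ultimately show ?thesis by (simp add: fun_upd_def)
  qed
qed simp

lemma chain_length_update_first:
  assumes "0 < N"
  shows "chain_length N (p(0 := z)) + dist (p 0) (p 1) = chain_length N p + dist z (p 1)"
  using assms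
proof (induction N)
  case (Suc N)
  then show ?case by (cases N) auto
qed simp

lemma chain_length_update_last:
  "chain_length (Suc m) (p(Suc m := z)) + dist (p m) (p (Suc m)) = chain_length (Suc m) p + dist (p m) z"
proof -
  have "chain_length m (p(Suc m := z)) = chain_length m p"
    by (rule chain_length_cong) auto
  then show ?thesis by (simp add: fun_upd_def)
qed

context small_disks
begin

text \<open>
  The first-order conditions for a shortest chain through the disks \<open>\<sigma> 0, \<dots>, \<sigma> N\<close>. At both ends the single
  neighbour is counted twice (whence \<open>p (Suc N) = p (N - 1)\<close>), which turns the condition that the chain
  leaves or hits the disk orthogonally into an instance of the condition at the inner points.
\<close>
definition taut_chain :: "nat \<Rightarrow> (nat \<Rightarrow> int \<times> int) \<Rightarrow> (nat \<Rightarrow> plane) \<Rightarrow> bool" where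
  "taut_chain N \<sigma> p \<longleftrightarrow>
     (\<forall>i\<le>N. norm (p i - center n (\<sigma> i)) = r \<and> p (Suc i) \<noteq> p i \<and>
        (\<exists>\<mu>>0. p i - center n (\<sigma> i) =
           \<mu> *\<^sub>R (sgn (p (if i = 0 then 1 else i - 1) - p i) + sgn (p (Suc i) - p i)))) \<and>
     p (Suc N) = p (N - 1)"

text \<open>
  Varying one point of a shortest chain while the others are fixed shows that it is a shortest
  detour between its neighbours.
\<close>
lemma taut_chain_exists:
  assumes N: "0 < N"
    and legs: "\<And>i. i < N \<Longrightarrow> leg (\<sigma> i) (\<sigma> (Suc i))"
    and turns: "\<And>i. Suc i < N \<Longrightarrow> turn (\<sigma> i) (\<sigma> (Suc i)) (\<sigma> (Suc (Suc i)))"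
  obtains p where "taut_chain N \<sigma> p"
    and "\<And>q. (\<And>i. q i \<in> disk (\<sigma> i)) \<Longrightarrow> chain_length N p \<le> chain_length N q"
proof -
  obtain p' where p': "\<And>i. p' i \<in> disk (\<sigma> i)"
    and min: "\<And>q. (\<And>i. q i \<in> disk (\<sigma> i)) \<Longrightarrow> chain_length N p' \<le> chain_length N q"
  proof (rule shortest_chain_exists[of "\<lambda>i. disk (\<sigma> i)"])
    show "disk (\<sigma> i) \<noteq> {}" for i using r_pos by simp
  qed auto
  define p where "p = p'(Suc N := p' (N - 1))"
  define pre where "pre i = (if i = 0 then 1 else i - 1)" for i :: nat
  define suc where "suc i = (if i = N then N - 1 else Suc i)" for i :: nat
  have p_eq: "p i = p' i" if "i \<le> N" for i using that by (simp add: p_def)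
  have len: "chain_length N p = chain_length N p'" by (rule chain_length_cong) (simp add: p_eq)
  have pS: "p (Suc i) = p' (suc i)" if "i \<le> N" for i using that by (simp add: p_def suc_def)
  have pP: "p (pre i) = p' (pre i)" if "i \<le> N" for i
    using that N by (intro p_eq) (auto simp: pre_def)
  have upd: "chain_length N p' \<le> chain_length N (p'(i := z))" if "z \<in> disk (\<sigma> i)" for i z
    using p' that by (intro min) auto
  have local_min: "dist (p' (pre i)) (p' i) + dist (p' i) (p' (suc i))
                 \<le> dist (p' (pre i)) z + dist z (p' (suc i))"
    if iN: "i \<le> N" and z: "z \<in> disk (\<sigma> i)" for i z
  proof -
    consider "i = 0" | "i = N" "i \<noteq> 0" | m where "i = Suc m" "Suc m < N"
      using iN by (cases i; cases "i = N") auto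
    then show ?thesis
    proof cases
      case 1
      then show ?thesis using upd[OF z] chain_length_update_first[of N p' z] N
        by (simp add: pre_def suc_def dist_commute)
    next
      case 2
      then obtain m where "N = Suc m" by (cases N) auto
      then show ?thesis using 2 upd[OF z] chain_length_update_last[of m p' z]
        by (simp add: pre_def suc_def dist_commute)
    next
      case 3
      then show ?thesis using upd[OF z] chain_length_update_inner[of m N p' z]
        by (simp add: pre_def suc_def)
    qed
  qed
  have nbrs: "leg (\<sigma> (pre i)) (\<sigma> i) \<and> leg (\<sigma> i) (\<sigma> (suc i)) \<and> turn (\<sigma> (pre i)) (\<sigma> i) (\<sigma> (suc i))"
    if iN: "i \<le> N" for i
  proof -
    consider "i = 0" | "i = N" "i \<noteq> 0" | m where "i = Suc m" "Suc m < N"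
      using iN by (cases i; cases "i = N") auto
    then show ?thesis
    proof cases
      case 1
      then show ?thesis using legs[of 0] N by (auto simp: pre_def suc_def leg_commute turn_def)
    next
      case 2
      then obtain m where "N = Suc m" by (cases N) auto
      then show ?thesis using 2 legs[of m] by (auto simp: pre_def suc_def leg_commute turn_def)
    next
      case 3
      then show ?thesis using legs[of m] legs[of "Suc m"] turns[of m]
        by (auto simp: pre_def suc_def)
    qed
  qed
  have "taut_chain N \<sigma> p"
    unfolding taut_chain_def
  proof (intro conjI allI impI)
    show "p (Suc N) = p (N - 1)" using N by (simp add: p_def)
  next
    fix i assume i: "i \<le> N"
    have disj: "convex hull (disk (\<sigma> (pre i)) \<union> disk (\<sigma> (suc i))) \<inter> disk (\<sigma> i) = {}"
      using nbrs[OF i] by (intro turn_hull_disjoint) auto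
    have "closed_segment (p' (pre i)) (p' (suc i)) \<subseteq> convex hull (disk (\<sigma> (pre i)) \<union> disk (\<sigma> (suc i)))"
      using p' by (intro closed_segment_subset convex_convex_hull) (auto intro!: hull_inc)
    then have seg: "closed_segment (p' (pre i)) (p' (suc i)) \<inter> disk (\<sigma> i) = {}" using disj by blast
    obtain \<mu> where \<mu>: "\<mu> > 0"
      "p' i - center n (\<sigma> i) = \<mu> *\<^sub>R (sgn (p' (pre i) - p' i) + sgn (p' (suc i) - p' i))"
      "norm (p' i - center n (\<sigma> i)) = r"
      using shortest_detour_normal[OF r_pos p' local_min[OF i] seg] by blast
    show "norm (p i - center n (\<sigma> i)) = r" using \<mu>(3) i by (simp add: p_eq)
    have "p' (suc i) \<notin> disk (\<sigma> i)" using seg by auto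
    then show "p (Suc i) \<noteq> p i" using p'[of i] pS[OF i] p_eq[OF i] by metis
    show "\<exists>\<mu>>0. p i - center n (\<sigma> i) =
           \<mu> *\<^sub>R (sgn (p (if i = 0 then 1 else i - 1) - p i) + sgn (p (Suc i) - p i))"
      using \<mu> pS[OF i] p_eq[OF i] pP[OF i] unfolding pre_def by auto
  qed
  moreover have "chain_length N p \<le> chain_length N q" if "\<And>i. q i \<in> disk (\<sigma> i)" for q
    using min[of q] that len by simp
  ultimately show thesis by (rule that)
qed

lemma taut_chain_billiard:
  assumes N: "0 < N"
    and legs: "\<And>i. i < N \<Longrightarrow> leg (\<sigma> i) (\<sigma> (Suc i))"
    and taut: "taut_chain N \<sigma> p"
  obtains x v where "billiard_segment n r (chain_length N p) x v"
    and "\<And>i t. i < N \<Longrightarrow> chain_length i p \<le> t \<Longrightarrow> t \<le> chain_length (Suc i) p \<Longrightarrow>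
           x t = p i + (t - chain_length i p) *\<^sub>R sgn (p (Suc i) - p i)"
    and "visits n r (chain_length N p) x (map \<sigma> [0..<Suc N])"
proof -
  have norm_r: "norm (p i - center n (\<sigma> i)) = r" if "i \<le> N" for i
    using taut that by (auto simp: taut_chain_def)
  have ne: "p (Suc i) \<noteq> p i" if "i \<le> N" for i
    using taut that by (auto simp: taut_chain_def)
  have normal: "\<exists>\<mu>>0. p i - center n (\<sigma> i) =
           \<mu> *\<^sub>R (sgn (p (if i = 0 then 1 else i - 1) - p i) + sgn (p (Suc i) - p i))"
    if "i \<le> N" for i
    using taut that by (auto simp: taut_chain_def)
  have on: "dist (center n (\<sigma> i)) (p i) = r" if "i \<le> N" for i
    using norm_r[OF that] by (simp add: dist_norm norm_minus_commute)
  show thesis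
  proof (rule polygon_billiard_segment[of r N n \<sigma> p, OF r_pos on])
    show "q = \<sigma> i" if "i \<le> N" "dist (center n q) (p i) \<le> r" for i q
    proof (rule ccontr)
      assume "q \<noteq> \<sigma> i"
      then have "1 / real n \<le> dist (center n q) (center n (\<sigma> i))" by (rule centers_apart)
      also have "\<dots> \<le> 2 * r"
        using dist_triangle[of "center n q" "center n (\<sigma> i)" "p i"] on[of i] that
        by (simp add: dist_commute)
      finally show False using r_less r_pos n_pos by (simp add: field_simps)
    qed
    show "p (Suc i) \<noteq> p i" if "i \<le> N" for i by (rule ne[OF that])
    show "sgn (p (Suc (Suc i)) - p (Suc i)) =
                 reflect (sgn (p (Suc i) - center n (\<sigma> (Suc i)))) (sgn (p (Suc i) - p i))"
      if i: "i < N" for i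
    proof -
      let ?u = "sgn (p i - p (Suc i))" and ?v = "sgn (p (Suc (Suc i)) - p (Suc i))"
      obtain \<mu> where \<mu>: "\<mu> > 0" "p (Suc i) - center n (\<sigma> (Suc i)) = \<mu> *\<^sub>R (?u + ?v)"
        using normal[of "Suc i"] i by auto
      have "?u + ?v \<noteq> 0" using \<mu> norm_r[of "Suc i"] i r_pos by auto
      moreover have "norm ?u = 1" "norm ?v = 1"
        using ne[of i] ne[of "Suc i"] i by (auto simp: norm_sgn)
      ultimately have "reflect (sgn (?u + ?v)) (- ?u) = ?v" by (intro reflect_bisector)
      moreover have "sgn (p (Suc i) - center n (\<sigma> (Suc i))) = sgn (?u + ?v)"
        using \<mu> by (simp add: sgn_scaleR)
      moreover have "sgn (p (Suc i) - p i) = - ?u"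
        using sgn_minus[of "p i - p (Suc i)"] by simp
      ultimately show ?thesis by simp
    qed
    show "p i + \<theta> *\<^sub>R (p (Suc i) - p i) \<notin> disk q" if i: "i < N" and \<theta>: "0 < \<theta>" "\<theta> < 1" for i q \<theta>
    proof -
      consider "q = \<sigma> i" | "q = \<sigma> (Suc i)" | "q \<noteq> \<sigma> i" "q \<noteq> \<sigma> (Suc i)" by blast
      then show ?thesis
      proof cases
        case 1
        obtain \<mu> where "\<mu> > 0" "p i - center n (\<sigma> i) =
           \<mu> *\<^sub>R (sgn (p (if i = 0 then 1 else i - 1) - p i) + sgn (p (Suc i) - p i))"
          using normal[of i] i by auto
        from shortest_detour_leaves_ball[OF this norm_r _ \<theta>(1)] ne[of i] i 1
        show ?thesis by simp
      next
        case 2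
        obtain \<mu> where \<mu>: "\<mu> > 0" "p (Suc i) - center n (\<sigma> (Suc i)) =
           \<mu> *\<^sub>R (sgn (p (Suc (Suc i)) - p (Suc i)) + sgn (p i - p (Suc i)))"
          using normal[of "Suc i"] i by (auto simp: add.commute)
        have "p (Suc i) + (1 - \<theta>) *\<^sub>R (p i - p (Suc i)) \<notin> disk (\<sigma> (Suc i))"
          using shortest_detour_leaves_ball[OF \<mu> norm_r, of "1 - \<theta>"] ne[of i] i \<theta> by auto
        then show ?thesis using 2 by (simp add: algebra_simps)
      next
        case 3
        have "p i + \<theta> *\<^sub>R (p (Suc i) - p i) \<in> closed_segment (p i) (p (Suc i))"
          using \<theta> by (auto simp: in_segment algebra_simps intro!: exI[of _ \<theta>])
        also have "\<dots> \<subseteq> convex hull (disk (\<sigma> i) \<union> disk (\<sigma> (Suc i)))"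
          using on[of i] on[of "Suc i"] i
          by (intro closed_segment_subset convex_convex_hull) (auto intro!: hull_inc)
        finally show ?thesis using leg_hull_disjoint[OF legs[OF i] 3] by blast
      qed
    qed
  qed (use that in blast)+
qed

lemma admissible_itinerary_route:
  assumes legs: "\<And>i. i < N \<Longrightarrow> leg (\<sigma> i) (\<sigma> (Suc i))"
    and turns: "\<And>i. Suc i < N \<Longrightarrow> turn (\<sigma> i) (\<sigma> (Suc i)) (\<sigma> (Suc (Suc i)))"
  shows "admissible_itinerary n r (map \<sigma> [0..<Suc N])"
proof -
  have sub: "convex hull (obstacle n r q \<union> obstacle n r q') \<subseteq> convex hull (disk q \<union> disk q')" for q q'
    unfolding obstacle_def by (intro hull_mono Un_mono ball_subset_cball)
  have sub': "obstacle n r q \<subseteq> disk q" for q by (auto simp: obstacle_def)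
  have nth: "map \<sigma> [0..<Suc N] ! i = \<sigma> i" if "i < Suc N" for i
    using that by (simp del: upt_Suc)
  show ?thesis
    unfolding admissible_itinerary_def
  proof (intro conjI allI impI)
    fix i assume i: "i + 1 < length (map \<sigma> [0..<Suc N])"
    then have l: "leg (\<sigma> i) (\<sigma> (Suc i))" using legs[of i] by simp
    show "map \<sigma> [0..<Suc N] ! i \<noteq> map \<sigma> [0..<Suc N] ! (i + 1)"
      using i l by (auto simp: nth leg_def simp del: upt_Suc)
    fix q assume "q \<noteq> map \<sigma> [0..<Suc N] ! i \<and> q \<noteq> map \<sigma> [0..<Suc N] ! (i + 1)"
    then have "convex hull (disk (\<sigma> i) \<union> disk (\<sigma> (Suc i))) \<inter> disk q = {}"
      using i by (intro leg_hull_disjoint[OF l]) (auto simp: nth simp del: upt_Suc)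
    then show "convex hull (obstacle n r (map \<sigma> [0..<Suc N] ! i) \<union>
        obstacle n r (map \<sigma> [0..<Suc N] ! (i + 1))) \<inter> obstacle n r q = {}"
      using i sub[of "\<sigma> i" "\<sigma> (Suc i)"] sub'[of q] by (auto simp: nth simp del: upt_Suc)
  next
    fix i assume i: "i + 2 < length (map \<sigma> [0..<Suc N])"
    then have "convex hull (disk (\<sigma> i) \<union> disk (\<sigma> (Suc (Suc i)))) \<inter> disk (\<sigma> (Suc i)) = {}"
      using legs[of i] legs[of "Suc i"] turns[of i] by (intro turn_hull_disjoint) auto
    then show "obstacle n r (map \<sigma> [0..<Suc N] ! (i + 1)) \<inter>
        convex hull (obstacle n r (map \<sigma> [0..<Suc N] ! i) \<union> obstacle n r (map \<sigma> [0..<Suc N] ! (i + 2))) = {}"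
      using i sub[of "\<sigma> i" "\<sigma> (Suc (Suc i))"] sub'[of "\<sigma> (Suc i)"]
      by (auto simp: nth simp del: upt_Suc)
  qed
qed

end

section \<open>Crossing words on time intervals\<close>

text \<open>Words on open intervals can be concatenated at times at which no wall is crossed.\<close>
definition crossing_word_on ::
    "nat \<Rightarrow> real \<Rightarrow> (real \<Rightarrow> plane) \<Rightarrow> real \<Rightarrow> real \<Rightarrow> letter list \<Rightarrow> bool" where
  "crossing_word_on n r x s t w \<longleftrightarrow>
     (\<exists>ts. sorted_wrt (<) ts \<and> set ts = {u \<in> {s<..<t}. \<exists>l. wall_crossing n r x u l} \<and>
           list_all2 (wall_crossing n r x) ts w)"

lemma crossing_word_iff: "crossing_word n r T x w \<longleftrightarrow> crossing_word_on n r x 0 T w"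
  by (simp add: crossing_word_def crossing_word_on_def)

lemma crossing_word_on_append:
  assumes "crossing_word_on n r x s t w" "crossing_word_on n r x t u w'"
    and "s < t" "t < u" and nc: "\<And>l. \<not> wall_crossing n r x t l"
  shows "crossing_word_on n r x s u (w @ w')"
proof -
  obtain ts where ts: "sorted_wrt (<) ts" "set ts = {u \<in> {s<..<t}. \<exists>l. wall_crossing n r x u l}"
    "list_all2 (wall_crossing n r x) ts w"
    using assms(1) by (auto simp: crossing_word_on_def)
  obtain ts' where ts': "sorted_wrt (<) ts'" "set ts' = {v \<in> {t<..<u}. \<exists>l. wall_crossing n r x v l}"
    "list_all2 (wall_crossing n r x) ts' w'"
    using assms(2) by (auto simp: crossing_word_on_def)
  have "set (ts @ ts') = {v \<in> {s<..<u}. \<exists>l. wall_crossing n r x v l}"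
  proof (intro set_eqI iffI)
    fix v assume "v \<in> {v \<in> {s<..<u}. \<exists>l. wall_crossing n r x v l}"
    moreover from this have "v \<noteq> t" using nc by blast
    ultimately show "v \<in> set (ts @ ts')" by (auto simp: ts(2) ts'(2))
  qed (use \<open>s < t\<close> \<open>t < u\<close> in \<open>auto simp: ts(2) ts'(2)\<close>)
  moreover have "sorted_wrt (<) (ts @ ts')"
    using ts ts' by (auto simp: sorted_wrt_append)
  moreover have "list_all2 (wall_crossing n r x) (ts @ ts') (w @ w')"
    using ts(3) ts'(3) by (rule list_all2_appendI)
  ultimately show ?thesis unfolding crossing_word_on_def by blast
qed

lemma wall_crossing_coords:
  assumes "wall_crossing n r x t l"
  shows "fst (x t) \<in> \<int> \<or> snd (x t) \<in> \<int>"
proof (cases l)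
  case (Pair g pos)
  show ?thesis
  proof (cases g)
    case Gen_a
    then obtain p m :: int where "x t - (of_int p, of_int m) \<in> wall_a r"
      using assms Pair by auto
    then have "fst (x t) = of_int p" by (auto simp: wall_a_def mem_Times_iff)
    then show ?thesis by simp
  next
    case (Gen_b i)
    then obtain p m :: int where "x t - (of_int p, of_int m) \<in> wall_b n r i"
      using assms Pair by auto
    then have "snd (x t) = of_int m" by (auto simp: wall_b_def mem_Times_iff)
    then show ?thesis by simp
  qed
qed

lemma crossing_word_on_Nil:
  assumes "\<And>u. s < u \<Longrightarrow> u < t \<Longrightarrow> fst (x u) \<notin> \<int> \<and> snd (x u) \<notin> \<int>"
  shows "crossing_word_on n r x s t []"
  using assms wall_crossing_coords unfolding crossing_word_on_def
  by (intro exI[of _ "[]"]) fastforce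

lemma crossing_word_on_single:
  assumes "s < t\<^sub>0" "t\<^sub>0 < t" "wall_crossing n r x t\<^sub>0 l"
    and "\<And>u. s < u \<Longrightarrow> u < t \<Longrightarrow> u \<noteq> t\<^sub>0 \<Longrightarrow> fst (x u) \<notin> \<int> \<and> snd (x u) \<notin> \<int>"
  shows "crossing_word_on n r x s t [l]"
  unfolding crossing_word_on_def
proof (intro exI[of _ "[t\<^sub>0]"] conjI)
  show "set [t\<^sub>0] = {u \<in> {s<..<t}. \<exists>l. wall_crossing n r x u l}"
  proof (intro set_eqI iffI)
    fix u assume "u \<in> {u \<in> {s<..<t}. \<exists>l. wall_crossing n r x u l}"
    then have u: "s < u" "u < t" and "\<exists>l. wall_crossing n r x u l" by auto
    then have "fst (x u) \<in> \<int> \<or> snd (x u) \<in> \<int>" using wall_crossing_coords by blast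
    then show "u \<in> set [t\<^sub>0]" using assms(4)[OF u] by auto
  next
    fix u assume "u \<in> set [t\<^sub>0]"
    then have "u = t\<^sub>0" by simp
    show "u \<in> {u \<in> {s<..<t}. \<exists>l. wall_crossing n r x u l}"
      unfolding \<open>u = t\<^sub>0\<close> using assms(1-3) by (intro CollectI conjI exI[of _ l]) auto
  qed
qed (use assms(3) in auto)

lemma strict_mono_on_crosses_up:
  assumes "strict_mono_on {a..b} f" "a < t" "t < b"
  shows "crosses_up f t"
  unfolding crosses_up_def
proof
  have "\<forall>\<^sub>F s in at_left t. s \<in> {a<..<t}" using assms by (intro eventually_at_left_real)
  then show "\<forall>\<^sub>F s in at_left t. f s < f t"
    by eventually_elim (use assms in \<open>auto intro: strict_mono_onD\<close>)
  have "\<forall>\<^sub>F s in at_right t. s \<in> {t<..<b}" using assms by (intro eventually_at_right_real)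
  then show "\<forall>\<^sub>F s in at_right t. f t < f s"
    by eventually_elim (use assms in \<open>auto intro: strict_mono_onD\<close>)
qed

lemma strict_mono_on_crosses:
  fixes \<epsilon> :: int and c :: real
  assumes mono: "strict_mono_on {a..b} (\<lambda>s. of_int \<epsilon> * (f s - c))" and "a < t" "t < b"
    and "\<epsilon> = 1 \<or> \<epsilon> = -1"
  shows "if \<epsilon> = 1 then crosses_up f t else crosses_down f t"
  using assms(4)
proof
  assume "\<epsilon> = 1"
  then show ?thesis
    using strict_mono_on_crosses_up[OF assms(1-3)] by (simp add: crosses_up_def)
next
  assume "\<epsilon> = -1"
  then show ?thesis
    using strict_mono_on_crosses_up[OF assms(1-3)] by (simp add: crosses_up_def crosses_down_def)
qed

lemma not_Ints_between:
  fixes x :: real and m :: int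
  assumes "of_int m < x" "x < of_int m + 1"
  shows "x \<notin> \<int>"
proof
  assume "x \<in> \<int>"
  then obtain k where "x = of_int k" by (rule Ints_cases)
  then have "m < k" "k < m + 1" using assms by linarith+
  then show False by simp
qed

context small_disks
begin

section \<open>The crossing word of a taut chain\<close>

definition leg_word :: "int \<times> int \<Rightarrow> int \<times> int \<Rightarrow> letter list" where
  "leg_word q q' =
     (if fst q' div int n = fst q div int n then []
      else [(Gen_a, fst q div int n < fst q' div int n)])"

text \<open>
  The wall to the left of the disk \<open>(j, k)\<close> is a lift of the one with index \<open>j mod n\<close>, the wall to its right
  a lift of the next one. If the neighbours of a disk in the route lie to its left on average, the
  trajectory passes the disk on the left.
\<close>
definition turn_word :: "int \<times> int \<Rightarrow> int \<times> int \<Rightarrow> int \<times> int \<Rightarrow> letter list" where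
  "turn_word q q' q'' =
     (if snd q = snd q'' then []
      else [(Gen_b (nat (fst q' mod int n) + (if fst q + fst q'' < 2 * fst q' then 0 else 1)),
             snd q < snd q'')])"

text \<open>
  The legs are cut at the fractions \<open>\<delta>\<close> and \<open>1 - \<delta>\<close>. The fraction is so large that the trajectory has left
  the height of the disk at the cut, and so small that it has not yet reached a vertical wall. Thus the
  middle parts meet the vertical walls only, and the parts near a disk the horizontal ones only.
\<close>
definition \<delta> :: real where "\<delta> = 1 / (8 * real n)"

lemma \<delta>_pos: "0 < \<delta>" and \<delta>_less: "\<delta> < 1 / 4" and \<delta>_n: "1 / real n = 8 * \<delta>"
  and r_\<delta>: "25 * r < 2 * \<delta>"
proof -
  show "0 < \<delta>" "1 / real n = 8 * \<delta>" using n_pos by (auto simp: \<delta>_def)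
  show "\<delta> < 1 / 4" using n3 by (simp add: \<delta>_def field_simps)
  show "25 * r < 2 * \<delta>" using r_less by (simp add: \<delta>_def)
qed

text \<open>
  The total rise of a leg is at least \<open>1 - 2 * r\<close>, so after the fraction \<open>\<delta>\<close> it has cleared the disk,
  wherever on the boundary of the disk it started.
\<close>
lemma \<delta>_rise: "4 * r < \<delta> * (1 - 2 * r)"
proof -
  have "\<delta> * (1 - 2 * r) \<ge> \<delta> * (2 / 3)" using \<delta>_pos r_less_300th by (intro mult_left_mono) auto
  then show ?thesis using r_\<delta> r_pos by linarith
qed

lemma disk_coords:
  assumes "P \<in> disk q"
  shows "\<bar>fst P - of_int (fst q) / real n\<bar> \<le> r" "\<bar>snd P - of_int (snd q)\<bar> \<le> r"
  using assms dist_fst_le[of "center n q" P] dist_snd_le[of "center n q" P]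
  by (auto simp: center_def dist_real_def)

lemma leg_differences:
  assumes leg: "leg q q'" and P: "P \<in> disk q" "P' \<in> disk q'"
  shows "\<bar>fst P' - fst P\<bar> \<le> 2 + 2 * r"
    and "\<bar>(snd P' - snd P) - of_int (snd q' - snd q)\<bar> \<le> 2 * r"
proof -
  have "\<bar>fst q' - fst q\<bar> \<le> 2 * int n" using leg by (simp add: leg_def)
  then have "\<bar>of_int (fst q' - fst q)\<bar> \<le> 2 * real n" by linarith
  then have "\<bar>of_int (fst q' - fst q) / real n\<bar> \<le> 2" using n_pos by (simp add: field_simps)
  then show "\<bar>fst P' - fst P\<bar> \<le> 2 + 2 * r"
    using disk_coords[OF P(1)] disk_coords[OF P(2)] by (simp add: diff_divide_distrib)
  show "\<bar>(snd P' - snd P) - of_int (snd q' - snd q)\<bar> \<le> 2 * r"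
    using disk_coords[OF P(1)] disk_coords[OF P(2)] by simp
qed

lemma column_bounds:
  assumes "\<not> int n dvd j"
  shows "of_int (j div int n) + 8 * \<delta> \<le> of_int j / real n"
    and "of_int j / real n \<le> of_int (j div int n) + 1 - 8 * \<delta>"
proof -
  define c m where "c = j div int n" and "m = j mod int n"
  have j: "j = c * int n + m" by (simp add: c_def m_def)
  have "m \<noteq> 0" "0 \<le> m" "m < int n"
    using assms n3 by (auto simp: m_def dvd_eq_mod_eq_0)
  then have m: "1 \<le> m" "m \<le> int n - 1" by auto
  have "of_int j / real n = of_int c + of_int m / real n"
    using n_pos by (simp add: j add_divide_distrib)
  moreover have "1 / real n \<le> of_int m / real n" using m n_pos by (simp add: divide_right_mono)
  moreover have "of_int m / real n \<le> 1 - 1 / real n" using m n_pos by (simp add: field_simps)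
  ultimately show "of_int (j div int n) + 8 * \<delta> \<le> of_int j / real n"
    "of_int j / real n \<le> of_int (j div int n) + 1 - 8 * \<delta>"
    unfolding c_def[symmetric] \<delta>_n[symmetric] by linarith+
qed

lemma near_vertex:
  assumes leg: "leg q q'" and P: "P \<in> disk q" "P' \<in> disk q'" and \<theta>: "0 \<le> \<theta>" "\<theta> \<le> \<delta>"
    and z: "z = P + \<theta> *\<^sub>R (P' - P)"
  shows "\<bar>fst z - of_int (fst q) / real n\<bar> \<le> 4 * \<delta>" "\<bar>snd z - of_int (snd q)\<bar> < 1" "fst z \<notin> \<int>"
proof -
  note d = leg_differences[OF leg P]
  have "\<bar>\<theta> * (fst P' - fst P)\<bar> \<le> \<delta> * 3"
    using \<theta> d(1) r_less_300th r_pos unfolding abs_mult by (intro mult_mono) auto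
  moreover have "fst z = fst P + \<theta> * (fst P' - fst P)" by (simp add: z)
  ultimately show x: "\<bar>fst z - of_int (fst q) / real n\<bar> \<le> 4 * \<delta>"
    using disk_coords(1)[OF P(1)] r_\<delta> r_pos by linarith
  have "\<bar>snd q' - snd q\<bar> = 1" using leg by (simp add: leg_def)
  then have "\<bar>of_int (snd q' - snd q)\<bar> = (1::real)" by linarith
  then have "\<bar>snd P' - snd P\<bar> \<le> 2" using d(2) r_less_300th by linarith
  then have "\<bar>\<theta> * (snd P' - snd P)\<bar> \<le> \<delta> * 2"
    using \<theta> unfolding abs_mult by (intro mult_mono) auto
  moreover have "snd z = snd P + \<theta> * (snd P' - snd P)" by (simp add: z)
  ultimately show "\<bar>snd z - of_int (snd q)\<bar> < 1"
    using disk_coords(2)[OF P(1)] r_less_300th \<delta>_less by linarith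
  have "\<not> int n dvd fst q" using leg by (simp add: leg_def)
  note column_bounds[OF this]
  then have "of_int (fst q div int n) < fst z" "fst z < of_int (fst q div int n) + 1"
    using x \<delta>_pos by linarith+
  then show "fst z \<notin> \<int>" by (rule not_Ints_between)
qed

lemma leg_middle_height:
  assumes leg: "leg q q'" and P: "P \<in> disk q" "P' \<in> disk q'" and \<theta>: "\<delta> \<le> \<theta>" "\<theta> \<le> 1 - \<delta>"
    and z: "z = P + \<theta> *\<^sub>R (P' - P)"
  shows "\<exists>m::int. of_int m + r \<le> snd z \<and> snd z \<le> of_int m + 1 - r" "snd z \<notin> \<int>"
proof -
  obtain \<epsilon> where e: "snd q' = snd q + \<epsilon>" "\<epsilon> = 1 \<or> \<epsilon> = -1" by (rule leg_cases[OF leg])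
  note d = leg_differences(2)[OF leg P]
  have sz: "snd z = snd P + \<theta> * (snd P' - snd P)"
           "snd z = snd P' - (1 - \<theta>) * (snd P' - snd P)" by (auto simp: z algebra_simps)
  have ex: "\<exists>m::int. of_int m + r < snd z \<and> snd z < of_int m + 1 - r"
    using e(2)
  proof
    assume e1: "\<epsilon> = 1"
    then have g: "1 - 2 * r \<le> snd P' - snd P" using d e by auto
    have "\<delta> * (1 - 2 * r) \<le> \<theta> * (snd P' - snd P)" "\<delta> * (1 - 2 * r) \<le> (1 - \<theta>) * (snd P' - snd P)"
      using \<theta> \<delta>_pos r_less_300th g by (auto intro!: mult_mono)
    then show ?thesis
      using disk_coords(2)[OF P(1)] disk_coords(2)[OF P(2)] e(1) e1 \<delta>_rise sz r_pos
      by (intro exI[of _ "snd q"]) auto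
  next
    assume e1: "\<epsilon> = -1"
    then have g: "1 - 2 * r \<le> snd P - snd P'" using d e by auto
    have "\<delta> * (1 - 2 * r) \<le> \<theta> * (snd P - snd P')" "\<delta> * (1 - 2 * r) \<le> (1 - \<theta>) * (snd P - snd P')"
      using \<theta> \<delta>_pos r_less_300th g by (auto intro!: mult_mono)
    then have "\<delta> * (1 - 2 * r) \<le> - (\<theta> * (snd P' - snd P))"
      "\<delta> * (1 - 2 * r) \<le> - ((1 - \<theta>) * (snd P' - snd P))"
      by (simp_all add: right_diff_distrib)
    then show ?thesis
      using disk_coords(2)[OF P(1)] disk_coords(2)[OF P(2)] e(1) e1 \<delta>_rise sz r_pos
      by (intro exI[of _ "snd q'"]) auto
  qed
  then show "\<exists>m::int. of_int m + r \<le> snd z \<and> snd z \<le> of_int m + 1 - r"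
    using less_imp_le by blast
  from ex obtain m :: int where "of_int m + r < snd z" "snd z < of_int m + 1 - r" by blast
  then show "snd z \<notin> \<int>" using r_pos by (intro not_Ints_between[of m]) auto
qed

text \<open>
  If the columns of the two disks are different, then the abscissa is strictly monotone and meets
  exactly one integer \<open>M\<close>. The sign \<open>e\<close> treats the two directions at once: \<open>g\<close> increases from a
  negative to a positive value.
\<close>
lemma leg_middle_word:
  assumes leg: "leg q q'" and P: "P \<in> disk q" "P' \<in> disk q'" and l: "0 < l"
    and x: "\<And>t. \<tau> \<le> t \<Longrightarrow> t \<le> \<tau> + l \<Longrightarrow> x t = P + ((t - \<tau>) / l) *\<^sub>R (P' - P)"
  shows "crossing_word_on n r x (\<tau> + \<delta> * l) (\<tau> + (1 - \<delta>) * l) (leg_word q q')"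
proof -
  define c c' where "c = fst q div int n" and "c' = fst q' div int n"
  have ndvd: "\<not> int n dvd fst q" "\<not> int n dvd fst q'" using leg by (auto simp: leg_def)
  note cb = column_bounds[OF ndvd(1), folded c_def] column_bounds[OF ndvd(2), folded c'_def]
  note dP = disk_coords(1)[OF P(1)] disk_coords(1)[OF P(2)]
  define a b where "a = \<tau> + \<delta> * l" and "b = \<tau> + (1 - \<delta>) * l"
  define \<theta> where "\<theta> t = (t - \<tau>) / l" for t
  have th: "\<delta> \<le> \<theta> t \<and> \<theta> t \<le> 1 - \<delta>" if "a \<le> t" "t \<le> b" for t
    using that l by (auto simp: \<theta>_def a_def b_def field_simps)
  have xt: "x t = P + \<theta> t *\<^sub>R (P' - P)" if "a \<le> t" "t \<le> b" for t
  proof -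
    have "0 \<le> \<delta> * l" "\<delta> * l \<le> 1 * l" using \<delta>_pos \<delta>_less l by (auto intro!: mult_right_mono)
    then have "\<tau> \<le> t" "t \<le> \<tau> + l" using that l by (auto simp: a_def b_def algebra_simps)
    then show ?thesis using x by (simp add: \<theta>_def)
  qed
  have snd_x: "snd (x t) \<notin> \<int>" if "a \<le> t" "t \<le> b" for t
    using leg_middle_height(2)[OF leg P _ _ xt] th that by blast
  have fst_x: "fst (x t) = (1 - \<theta> t) * fst P + \<theta> t * fst P'" if "a \<le> t" "t \<le> b" for t
    by (subst xt[OF that]) (simp add: algebra_simps)
  have "\<bar>c' - c\<bar> \<le> 1" using leg by (simp add: leg_def c_def c'_def)
  moreover define \<epsilon> where "\<epsilon> = c' - c"
  ultimately consider "c' = c" | "c' = c + \<epsilon>" "\<epsilon> = 1 \<or> \<epsilon> = -1" by fastforce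
  then show ?thesis
  proof cases
    case 1
    have "fst (x t) \<notin> \<int>" if "a \<le> t" "t \<le> b" for t
    proof -
      have "fst P \<in> {of_int c<..<of_int c + 1}" "fst P' \<in> {of_int c<..<of_int c + 1}"
        using cb dP 1 r_\<delta> \<delta>_pos by auto
      then have "(1 - \<theta> t) *\<^sub>R fst P + \<theta> t *\<^sub>R fst P' \<in> {of_int c<..<of_int c + 1}"
        using th[OF that] \<delta>_pos by (intro convexD_alt) auto
      then show ?thesis using fst_x[OF that] by (intro not_Ints_between[of c]) auto
    qed
    then have "crossing_word_on n r x a b []"
      using snd_x by (intro crossing_word_on_Nil) auto
    then show ?thesis using 1 by (simp add: leg_word_def a_def b_def c_def c'_def)
  next
    case 2
    define M where "M = max c c'"
    define e where "e = (of_int \<epsilon> :: real)"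
    define g where "g z = e * (z - of_int M)" for z :: real
    have e: "e = 1 \<or> e = -1" using 2 by (auto simp: e_def)
    have gP: "g (fst P) \<le> - 7 * \<delta>" "- 1 < g (fst P)" and gP': "7 * \<delta> \<le> g (fst P')" "g (fst P') < 1"
      using 2 cb dP r_\<delta> \<delta>_pos r_pos by (auto simp: g_def M_def e_def)
    define D where "D = g (fst P') - g (fst P)"
    have Dpos: "0 < D" using gP gP' \<delta>_pos by (simp add: D_def)
    have g_x: "g (fst (x t)) = g (fst P) + \<theta> t * D" if "a \<le> t" "t \<le> b" for t
      unfolding g_def D_def fst_x[OF that] by (simp add: algebra_simps)
    define \<theta>\<^sub>0 where "\<theta>\<^sub>0 = - g (fst P) / D"
    define t\<^sub>0 where "t\<^sub>0 = \<tau> + \<theta>\<^sub>0 * l"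
    have D3: "D \<le> 3"
      using e leg_differences(1)[OF leg P] r_less_300th unfolding D_def g_def by (elim disjE) auto
    have dD: "\<delta> * D \<le> \<delta> * 3" using D3 \<delta>_pos by (intro mult_left_mono) auto
    have "\<delta> * D < - g (fst P)" "\<delta> * D < g (fst P')"
      using dD \<delta>_pos gP gP' by linarith+
    moreover have "g (fst P') = g (fst P) + D" by (simp add: D_def)
    ultimately have "\<delta> * D < - g (fst P)" "- g (fst P) < (1 - \<delta>) * D"
      by (simp_all add: left_diff_distrib)
    then have th0: "\<delta> < \<theta>\<^sub>0" "\<theta>\<^sub>0 < 1 - \<delta>"
      unfolding \<theta>\<^sub>0_def using pos_less_divide_eq[OF Dpos] pos_divide_less_eq[OF Dpos] by blast+
    then have t0: "a < t\<^sub>0" "t\<^sub>0 < b" using l by (auto simp: t\<^sub>0_def a_def b_def)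
    have \<theta>t0: "\<theta> t\<^sub>0 = \<theta>\<^sub>0" using l by (simp add: \<theta>_def t\<^sub>0_def)
    have gt0: "g (fst (x t\<^sub>0)) = 0"
      using g_x[of t\<^sub>0] t0 \<theta>t0 Dpos by (simp add: \<theta>\<^sub>0_def)
    have mono: "strict_mono_on {a..b} (\<lambda>t. g (fst (x t)))"
    proof (rule strict_mono_onI)
      fix s t assume st: "s \<in> {a..b}" "t \<in> {a..b}" "s < t"
      then have "\<theta> s < \<theta> t" using l by (simp add: \<theta>_def divide_strict_right_mono)
      then show "g (fst (x s)) < g (fst (x t))" using g_x st Dpos by simp
    qed
    have nint: "fst (x t) \<notin> \<int>" if t: "a \<le> t" "t \<le> b" "t \<noteq> t\<^sub>0" for t
    proof -
      have "g (fst (x t)) \<noteq> 0"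
        using strict_mono_onD[OF mono, of t t\<^sub>0] strict_mono_onD[OF mono, of t\<^sub>0 t] t t0 gt0
        by (cases "t < t\<^sub>0") auto
      moreover have "(1 - \<theta> t) *\<^sub>R g (fst P) + \<theta> t *\<^sub>R g (fst P') \<in> {-1<..<1}"
        using th[OF t(1,2)] \<delta>_pos gP gP' by (intro convexD_alt) auto
      then have "- 1 < g (fst (x t))" "g (fst (x t)) < 1"
        using g_x[OF t(1,2)] by (auto simp: D_def algebra_simps)
      ultimately have "fst (x t) \<noteq> of_int M" "of_int M - 1 < fst (x t)" "fst (x t) < of_int M + 1"
        using e by (auto simp: g_def)
      then show ?thesis
        using not_Ints_between[of M "fst (x t)"] not_Ints_between[of "M - 1" "fst (x t)"] by fastforce
    qed
    have "fst (x t\<^sub>0) = of_int M" using gt0 e by (auto simp: g_def)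
    moreover obtain m :: int where "of_int m + r \<le> snd (x t\<^sub>0)" "snd (x t\<^sub>0) \<le> of_int m + 1 - r"
      using leg_middle_height(1)[OF leg P _ _ xt, of t\<^sub>0] th[of t\<^sub>0] t0 by auto
    ultimately have wall: "x t\<^sub>0 - (of_int M, of_int m) \<in> wall_a r"
      by (auto simp: wall_a_def mem_Times_iff)
    have "if \<epsilon> = 1 then crosses_up (\<lambda>s. fst (x s)) t\<^sub>0 else crosses_down (\<lambda>s. fst (x s)) t\<^sub>0"
      using mono t0 2(2) by (intro strict_mono_on_crosses[of a b]) (auto simp: g_def e_def)
    then have "wall_crossing n r x t\<^sub>0 (Gen_a, c < c')" using wall 2 by auto
    then have "crossing_word_on n r x a b [(Gen_a, c < c')]"
      using nint snd_x t0 by (intro crossing_word_on_single[of _ t\<^sub>0]) auto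
    then show ?thesis using 2 by (auto simp: leg_word_def a_def b_def c_def c'_def)
  qed
qed

lemma leg_rise:
  assumes leg: "leg q q'" and P: "P \<in> disk q" "P' \<in> disk q'"
    and e: "snd q' = snd q + \<epsilon>" "\<epsilon> = 1 \<or> \<epsilon> = -1"
  shows "\<bar>of_int \<epsilon> * (snd P' - snd P) - 1\<bar> \<le> 2 * r"
    and "1 - 2 * r \<le> of_int \<epsilon> * (snd P' - snd P)"
  using leg_differences(2)[OF leg P] e by auto

text \<open>
  When both neighbours are above the disk, so is the normal at \<open>C\<close>, and the trajectory near \<open>C\<close> stays above
  the horizontal line through the center; likewise below.
\<close>
lemma bounce_stays_off_walls:
  assumes legs: "leg q q\<^sub>0" "leg q q\<^sub>2" and same: "snd q\<^sub>0 = snd q\<^sub>2"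
    and mem: "A \<in> disk q\<^sub>0" "B \<in> disk q\<^sub>2" "C \<in> disk q"
    and normal: "\<mu> > 0" "C - center n q = \<mu> *\<^sub>R (sgn (A - C) + sgn (B - C))"
    and \<theta>: "0 \<le> \<theta>" "\<theta> \<le> \<delta>" and z: "z = C + \<theta> *\<^sub>R (B - C)"
  shows "fst z \<notin> \<int> \<and> snd z \<notin> \<int>"
proof
  show "fst z \<notin> \<int>" by (rule near_vertex(3)[OF legs(2) mem(3,2) \<theta> z])
  obtain \<epsilon> where e: "snd q\<^sub>0 = snd q + \<epsilon>" "\<epsilon> = 1 \<or> \<epsilon> = -1"
    by (rule leg_cases[OF legs(1)])
  define e where "e = (of_int \<epsilon> :: real)"
  have e1: "e = 1 \<or> e = -1" using e by (auto simp: e_def)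
  have a: "0 < e * (snd A - snd C)"
    using leg_rise(2)[OF legs(1) mem(3,1) e] r_less_300th by (simp add: e_def)
  have b: "0 < e * (snd B - snd C)"
    using leg_rise(2)[OF legs(2) mem(3,2) _ e(2)] same e r_less_300th by (simp add: e_def)
  have "A \<noteq> C" "B \<noteq> C" using a b by auto
  then have "0 < e * (snd A - snd C) / norm (A - C)" "0 < e * (snd B - snd C) / norm (B - C)"
    using a b by auto
  then have "0 < \<mu> * (e * (snd A - snd C) / norm (A - C) + e * (snd B - snd C) / norm (B - C))"
    using normal(1) by simp
  also have "\<dots> = e * snd (\<mu> *\<^sub>R (sgn (A - C) + sgn (B - C)))"
    by (simp add: sgn_div_norm divide_inverse algebra_simps)
  also have "\<dots> = e * (snd C - of_int (snd q))"
    unfolding normal(2)[symmetric] by (simp add: center_def)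
  finally have "0 < e * (snd C - of_int (snd q)) + \<theta> * (e * (snd B - snd C))"
    using b \<theta> by (simp add: add_pos_nonneg)
  also have "\<dots> = e * (snd z - of_int (snd q))" by (simp add: z algebra_simps)
  finally have pos: "0 < e * (snd z - of_int (snd q))" .
  have near: "\<bar>snd z - of_int (snd q)\<bar> < 1" by (rule near_vertex(2)[OF legs(2) mem(3,2) \<theta> z])
  show "snd z \<notin> \<int>"
    using e1
  proof
    assume "e = 1"
    then show ?thesis using pos near by (intro not_Ints_between[of "snd q"]) auto
  next
    assume "e = -1"
    then show ?thesis using pos near by (intro not_Ints_between[of "snd q - 1"]) auto
  qed
qed

text \<open>
  Let \<open>z\<close> be the point of the trajectory at the height of the center. Since \<open>C\<close> minus the center is a
  positive multiple of the sum of the two directions, elimination of the height shows that the sign of the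
  horizontal displacement of \<open>z\<close> is the sign of \<open>\<epsilon>\<close> times the cross product of \<open>A - C\<close> and
  \<open>B - C\<close>, where the sign \<open>\<epsilon>\<close> is the vertical direction of the motion. This differs from its value \<open>D\<close>
  for the three centers by less than \<open>1/n\<close>, and \<open>D\<close> is a nonzero multiple of \<open>1/n\<close>.
\<close>
lemma pass_side:
  assumes legs: "leg q q\<^sub>0" "leg q q\<^sub>2"
    and e: "snd q\<^sub>2 = snd q + \<epsilon>" "snd q\<^sub>0 = snd q - \<epsilon>" "\<epsilon> = 1 \<or> \<epsilon> = -1"
    and bend: "fst q\<^sub>0 + fst q\<^sub>2 \<noteq> 2 * fst q"
    and mem: "A \<in> disk q\<^sub>0" "B \<in> disk q\<^sub>2" "C \<in> disk q"
    and normal: "\<mu> > 0" "C - center n q = \<mu> *\<^sub>R (sgn (A - C) + sgn (B - C))"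
    and z: "z = C + \<theta> *\<^sub>R (B - C)" "snd z = of_int (snd q)"
  shows "fst z \<noteq> of_int (fst q) / real n"
    and "fst z < of_int (fst q) / real n \<longleftrightarrow> fst q\<^sub>0 + fst q\<^sub>2 < 2 * fst q"
proof -
  define e where "e = (of_int \<epsilon> :: real)"
  have e1: "e = 1 \<or> e = -1" and ee: "e * e = 1" using e by (auto simp: e_def)
  define a\<^sub>1 a\<^sub>2 b\<^sub>1 b\<^sub>2 where "a\<^sub>1 = fst A - fst C" and "a\<^sub>2 = snd A - snd C"
    and "b\<^sub>1 = fst B - fst C" and "b\<^sub>2 = snd B - snd C"
  have a2: "\<bar>- e * a\<^sub>2 - 1\<bar> \<le> 2 * r"
    using leg_rise(1)[OF legs(1) mem(3,1), of "- \<epsilon>"] e by (auto simp: e_def a\<^sub>2_def)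
  have b2: "\<bar>e * b\<^sub>2 - 1\<bar> \<le> 2 * r"
    using leg_rise(1)[OF legs(2) mem(3,2) e(1,3)] by (simp add: e_def b\<^sub>2_def)
  have a1: "\<bar>a\<^sub>1\<bar> \<le> 3" and b1: "\<bar>b\<^sub>1\<bar> \<le> 3"
    using leg_differences(1)[OF legs(1) mem(3,1)] leg_differences(1)[OF legs(2) mem(3,2)] r_less_300th
    by (auto simp: a\<^sub>1_def b\<^sub>1_def)
  \<comment> \<open>The side is the sign of \<open>E\<close>,\<close>
  define E where "E = e * (a\<^sub>1 * b\<^sub>2 - a\<^sub>2 * b\<^sub>1)"
  define X Y where "X = fst C - of_int (fst q) / real n" and "Y = snd C - of_int (snd q)"
  define na nb where "na = norm (A - C)" and "nb = norm (B - C)"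
  have "a\<^sub>2 \<noteq> 0" using a2 r_less_300th by auto
  then have na: "na > 0" by (auto simp: na_def a\<^sub>2_def)
  have X: "X = \<mu> * (a\<^sub>1 / na + b\<^sub>1 / nb)" and Y: "Y = \<mu> * (a\<^sub>2 / na + b\<^sub>2 / nb)"
    using arg_cong[OF normal(2), of fst] arg_cong[OF normal(2), of snd]
    by (simp_all add: X_def Y_def a\<^sub>1_def a\<^sub>2_def b\<^sub>1_def b\<^sub>2_def na_def nb_def center_def sgn_div_norm
        divide_inverse mult.commute)
  have Yz: "Y + \<theta> * b\<^sub>2 = 0" using z by (simp add: Y_def b\<^sub>2_def)
  have Xz: "fst z - of_int (fst q) / real n = X + \<theta> * b\<^sub>1" using z by (simp add: X_def b\<^sub>1_def)
  have "(fst z - of_int (fst q) / real n) * b\<^sub>2 = X * b\<^sub>2 + (\<theta> * b\<^sub>2) * b\<^sub>1"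
    unfolding Xz by (simp add: algebra_simps)
  also have "\<theta> * b\<^sub>2 = - Y" using Yz by simp
  also have "X * b\<^sub>2 + - Y * b\<^sub>1 = (\<mu> / na) * (a\<^sub>1 * b\<^sub>2 - a\<^sub>2 * b\<^sub>1)"
    unfolding X Y by (simp add: algebra_simps)
  finally have "e * ((fst z - of_int (fst q) / real n) * b\<^sub>2) = e * ((\<mu> / na) * (a\<^sub>1 * b\<^sub>2 - a\<^sub>2 * b\<^sub>1))"
    by (rule arg_cong)
  then have "(fst z - of_int (fst q) / real n) * (e * b\<^sub>2) = (\<mu> / na) * E"
    by (simp only: E_def ac_simps)
  moreover have "e * b\<^sub>2 > 0" using b2 r_less_300th by linarith
  moreover have "\<mu> / na > 0" using na normal(1) by simp
  ultimately have side: "fst z < of_int (fst q) / real n \<longleftrightarrow> E < 0"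
      "fst z = of_int (fst q) / real n \<longleftrightarrow> E = 0"
    by (smt (verit) mult_less_0_iff mult_eq_0_iff)+
  \<comment> \<open>which for small disks is the sign of the corresponding quantity for the centers.\<close>
  define D where "D = of_int (fst q\<^sub>0 + fst q\<^sub>2 - 2 * fst q) / real n"
  have "\<bar>a\<^sub>1 + b\<^sub>1 - D\<bar> \<le> 4 * r"
    using disk_coords(1)[OF mem(1)] disk_coords(1)[OF mem(2)] disk_coords(1)[OF mem(3)]
    by (simp add: D_def a\<^sub>1_def b\<^sub>1_def add_divide_distrib diff_divide_distrib)
  moreover have "\<bar>a\<^sub>1 * (e * b\<^sub>2 - 1)\<bar> \<le> 3 * (2 * r)"
    unfolding abs_mult using a1 b2 by (intro mult_mono) auto
  moreover have "\<bar>b\<^sub>1 * (- e * a\<^sub>2 - 1)\<bar> \<le> 3 * (2 * r)"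
    unfolding abs_mult using b1 a2 by (intro mult_mono) auto
  moreover have "E = a\<^sub>1 + b\<^sub>1 + a\<^sub>1 * (e * b\<^sub>2 - 1) + b\<^sub>1 * (- e * a\<^sub>2 - 1)"
    by (simp add: E_def algebra_simps)
  ultimately have ED: "\<bar>E - D\<bar> < 1 / real n"
    using r_\<delta> r_pos \<delta>_n by linarith
  have "\<bar>D\<bar> \<ge> 1 / real n" unfolding D_def by (intro int_div_n_ge) (use bend in auto)
  then have "E \<noteq> 0" "E < 0 \<longleftrightarrow> D < 0" using ED by linarith+
  moreover have "D < 0 \<longleftrightarrow> fst q\<^sub>0 + fst q\<^sub>2 < 2 * fst q"
  proof -
    have "D < 0 \<longleftrightarrow> (of_int (fst q\<^sub>0 + fst q\<^sub>2 - 2 * fst q) :: real) < 0"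
      using n_pos unfolding D_def by (simp only: divide_less_0_iff) auto
    then show ?thesis by (simp only: of_int_less_0_iff) auto
  qed
  ultimately show "fst z \<noteq> of_int (fst q) / real n"
    "fst z < of_int (fst q) / real n \<longleftrightarrow> fst q\<^sub>0 + fst q\<^sub>2 < 2 * fst q"
    using side by auto
qed

lemma wall_b_adjacent:
  assumes ndvd: "\<not> int n dvd fst q"
    and z: "\<bar>fst z - of_int (fst q) / real n\<bar> \<le> 4 * \<delta>" "snd z = of_int (snd q)"
      "z \<notin> ball (center n q) r"
    and side: "left \<longleftrightarrow> fst z < of_int (fst q) / real n"
    and i: "i = nat (fst q mod int n) + (if left then 0 else 1)"
  shows "i \<in> {1..n}" "z - (of_int (fst q div int n), of_int (snd q)) \<in> wall_b n r i"
proof -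
  define m c where "m = fst q mod int n" and "c = fst q div int n"
  have m: "1 \<le> m" "m < int n"
  proof -
    have "m \<noteq> 0" "0 \<le> m" "m < int n" using ndvd n3 by (auto simp: m_def dvd_eq_mod_eq_0)
    then show "1 \<le> m" "m < int n" by auto
  qed
  then show "i \<in> {1..n}" using i by (auto simp: m_def[symmetric])
  have "fst q = c * int n + m" by (simp add: c_def m_def)
  then have j: "of_int (fst q) / real n = of_int c + of_int m / real n"
    using n_pos by (simp add: add_divide_distrib)
  have "dist (center n q) z = \<bar>fst z - of_int (fst q) / real n\<bar>"
    using z(2) by (simp add: center_def dist_prod_def dist_real_def abs_minus_commute)
  then have far: "r \<le> \<bar>fst z - of_int (fst q) / real n\<bar>" using z(3) by simp
  have i': "real i / real n = of_int m / real n + (if left then 0 else 8 * \<delta>)"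
    "(real i - 1) / real n = of_int m / real n - (if left then 8 * \<delta> else 0)"
    using m n_pos unfolding i m_def[symmetric] \<delta>_n[symmetric]
    by (auto simp: add_divide_distrib diff_divide_distrib)
  have "(real i - 1) / real n + r \<le> fst z - of_int c" "fst z - of_int c \<le> real i / real n - r"
    unfolding i' using j far z(1) side r_\<delta> r_pos by (auto split: if_splits)
  then show "z - (of_int (fst q div int n), of_int (snd q)) \<in> wall_b n r i"
    using z(2) by (auto simp: wall_b_def mem_Times_iff c_def)
qed

text \<open>
  In a passage the height is strictly monotone near the disk, although the direction changes at the time
  \<open>\<tau>\<close> of the collision. It therefore equals the height of the center exactly once, before, at or after \<open>\<tau>\<close>,
  according to the position of \<open>C\<close>; if the crossing comes first, \<open>pass_side\<close> is applied to the
  reversed motion.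
\<close>
lemma turn_crossing_word:
  assumes legs: "leg q\<^sub>0 q" "leg q q\<^sub>2" and turn: "turn q\<^sub>0 q q\<^sub>2"
    and mem: "A \<in> disk q\<^sub>0" "B \<in> disk q\<^sub>2" "C \<in> disk q"
    and normal: "\<mu> > 0" "C - center n q = \<mu> *\<^sub>R (sgn (A - C) + sgn (B - C))"
    and l: "0 < l\<^sub>1" "0 < l\<^sub>2"
    and left: "\<And>t. \<tau> - l\<^sub>1 \<le> t \<Longrightarrow> t \<le> \<tau> \<Longrightarrow> x t = C + ((\<tau> - t) / l\<^sub>1) *\<^sub>R (A - C)"
    and right: "\<And>t. \<tau> \<le> t \<Longrightarrow> t \<le> \<tau> + l\<^sub>2 \<Longrightarrow> x t = C + ((t - \<tau>) / l\<^sub>2) *\<^sub>R (B - C)"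
    and avoid: "\<And>t. \<tau> - l\<^sub>1 \<le> t \<Longrightarrow> t \<le> \<tau> + l\<^sub>2 \<Longrightarrow> x t \<notin> ball (center n q) r"
  shows "crossing_word_on n r x (\<tau> - \<delta> * l\<^sub>1) (\<tau> + \<delta> * l\<^sub>2) (turn_word q\<^sub>0 q q\<^sub>2)"
proof -
  define a b where "a = \<tau> - \<delta> * l\<^sub>1" and "b = \<tau> + \<delta> * l\<^sub>2"
  have "\<delta> * l\<^sub>1 \<le> 1 * l\<^sub>1" "\<delta> * l\<^sub>2 \<le> 1 * l\<^sub>2" "0 < \<delta> * l\<^sub>1" "0 < \<delta> * l\<^sub>2"
    using \<delta>_less \<delta>_pos l by (auto intro!: mult_right_mono)
  then have ab: "\<tau> - l\<^sub>1 \<le> a" "a < \<tau>" "\<tau> < b" "b \<le> \<tau> + l\<^sub>2" by (auto simp: a_def b_def)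
  have legs': "leg q q\<^sub>0" using legs(1) by (simp add: leg_commute)
  have normal': "C - center n q = \<mu> *\<^sub>R (sgn (B - C) + sgn (A - C))"
    using normal(2) by (simp add: add.commute)
  have thl: "0 \<le> (\<tau> - t) / l\<^sub>1 \<and> (\<tau> - t) / l\<^sub>1 \<le> \<delta>" if "a \<le> t" "t \<le> \<tau>" for t
    using that l by (auto simp: a_def field_simps)
  have thr: "0 \<le> (t - \<tau>) / l\<^sub>2 \<and> (t - \<tau>) / l\<^sub>2 \<le> \<delta>" if "\<tau> \<le> t" "t \<le> b" for t
    using that l by (auto simp: b_def field_simps)
  have xl: "x t = C + ((\<tau> - t) / l\<^sub>1) *\<^sub>R (A - C)" if "a \<le> t" "t \<le> \<tau>" for t
    using left[of t] that ab by simp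
  have xr: "x t = C + ((t - \<tau>) / l\<^sub>2) *\<^sub>R (B - C)" if "\<tau> \<le> t" "t \<le> b" for t
    using right[of t] that ab by simp
  have near: "\<bar>fst (x t) - of_int (fst q) / real n\<bar> \<le> 4 * \<delta> \<and> \<bar>snd (x t) - of_int (snd q)\<bar> < 1 \<and>
      fst (x t) \<notin> \<int>" if t: "a \<le> t" "t \<le> b" for t
  proof (cases "t \<le> \<tau>")
    case True
    then show ?thesis
      using near_vertex[OF legs' mem(3,1) _ _ xl[of t]] thl[of t] t by auto
  next
    case False
    then show ?thesis
      using near_vertex[OF legs(2) mem(3,2) _ _ xr[of t]] thr[of t] t by auto
  qed
  show ?thesis
  proof (cases "snd q\<^sub>0 = snd q\<^sub>2")
    case True
    have "fst (x t) \<notin> \<int> \<and> snd (x t) \<notin> \<int>" if t: "a < t" "t < b" for t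
    proof (cases "t \<le> \<tau>")
      case before: True
      then show ?thesis
        using bounce_stays_off_walls[OF legs(2) legs' True[symmetric] mem(2,1,3) normal(1) normal' _ _ xl[of t]]
          thl[of t] t by auto
    next
      case False
      then show ?thesis
        using bounce_stays_off_walls[OF legs' legs(2) True mem(1,2,3) normal _ _ xr[of t]]
          thr[of t] t by auto
    qed
    then have "crossing_word_on n r x a b []" by (rule crossing_word_on_Nil)
    then show ?thesis using True by (simp add: turn_word_def a_def b_def)
  next
    case False
    obtain \<epsilon> where e0: "snd q\<^sub>2 = snd q + \<epsilon>" "\<epsilon> = 1 \<or> \<epsilon> = -1" by (rule leg_cases[OF legs(2)])
    obtain \<epsilon>' where e': "snd q\<^sub>0 = snd q + \<epsilon>'" "\<epsilon>' = 1 \<or> \<epsilon>' = -1" by (rule leg_cases[OF legs'])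
    have e: "snd q\<^sub>2 = snd q + \<epsilon>" "snd q\<^sub>0 = snd q - \<epsilon>" "\<epsilon> = 1 \<or> \<epsilon> = -1"
      using e0 e' False by auto
    have bend: "fst q\<^sub>0 + fst q\<^sub>2 \<noteq> 2 * fst q" using turn False by (simp add: turn_def)
    define e where "e = (of_int \<epsilon> :: real)"
    have e1: "e = 1 \<or> e = -1" using e(3) by (auto simp: e_def)
    define f where "f t = e * (snd (x t) - of_int (snd q))" for t
    define \<alpha> \<beta> \<gamma> where "\<alpha> = e * (snd C - snd A)" and "\<beta> = e * (snd B - snd C)"
      and "\<gamma> = e * (snd C - of_int (snd q))"
    have \<alpha>: "1 - 2 * r \<le> \<alpha>"
      using leg_rise(2)[OF legs' mem(3,1), of "- \<epsilon>"] e by (auto simp: \<alpha>_def e_def)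
    have \<beta>: "1 - 2 * r \<le> \<beta>"
      using leg_rise(2)[OF legs(2) mem(3,2) e(1,3)] by (auto simp: \<beta>_def e_def)
    have \<alpha>\<beta>_pos: "0 < \<alpha>" "0 < \<beta>" using \<alpha> \<beta> r_less_300th by linarith+
    have \<gamma>: "\<bar>\<gamma>\<bar> \<le> r" using disk_coords(2)[OF mem(3)] e1 by (auto simp: \<gamma>_def)
    then have \<gamma>': "\<gamma> \<le> r" "- \<gamma> \<le> r" by linarith+
    have "\<delta> * (1 - 2 * r) \<le> \<delta> * \<alpha>" "\<delta> * (1 - 2 * r) \<le> \<delta> * \<beta>"
      using \<alpha> \<beta> \<delta>_pos by (auto intro!: mult_left_mono)
    then have \<delta>\<alpha>: "r < \<delta> * \<alpha>" and \<delta>\<beta>: "r < \<delta> * \<beta>" using \<delta>_rise r_pos by linarith+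
    have fl: "f t = \<gamma> - ((\<tau> - t) / l\<^sub>1) * \<alpha>" if "a \<le> t" "t \<le> \<tau>" for t
      unfolding f_def xl[OF that] by (simp add: \<gamma>_def \<alpha>_def algebra_simps)
    have fr: "f t = \<gamma> + ((t - \<tau>) / l\<^sub>2) * \<beta>" if "\<tau> \<le> t" "t \<le> b" for t
      unfolding f_def xr[OF that] by (simp add: \<gamma>_def \<beta>_def algebra_simps)
    have less_l: "f s < f t" if st: "a \<le> s" "s < t" "t \<le> \<tau>" for s t
    proof -
      have "(\<tau> - t) / l\<^sub>1 < (\<tau> - s) / l\<^sub>1" using st l by (simp add: divide_strict_right_mono)
      from mult_strict_right_mono[OF this \<alpha>\<beta>_pos(1)] show ?thesis
        using fl[of s] fl[of t] st by linarith
    qed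
    have less_r: "f s < f t" if st: "\<tau> \<le> s" "s < t" "t \<le> b" for s t
    proof -
      have "(s - \<tau>) / l\<^sub>2 < (t - \<tau>) / l\<^sub>2" using st l by (simp add: divide_strict_right_mono)
      from mult_strict_right_mono[OF this \<alpha>\<beta>_pos(2)] show ?thesis
        using fr[of s] fr[of t] st by linarith
    qed
    have mono: "strict_mono_on {a..b} f"
    proof (rule strict_mono_onI)
      fix s t assume "s \<in> {a..b}" "t \<in> {a..b}" "s < t"
      then consider "a \<le> s" "s < t" "t \<le> \<tau>" | "\<tau> \<le> s" "s < t" "t \<le> b" | "a \<le> s" "s < \<tau>" "\<tau> < t" "t \<le> b"
        by force
      then show "f s < f t"
      proof cases
        case 3
        then show ?thesis using less_l[of s \<tau>] less_r[of \<tau> t] by simp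
      qed (auto intro: less_l less_r)
    qed
    have "\<exists>t\<^sub>0. a < t\<^sub>0 \<and> t\<^sub>0 < b \<and> f t\<^sub>0 = 0 \<and> fst (x t\<^sub>0) \<noteq> of_int (fst q) / real n \<and>
        (fst (x t\<^sub>0) < of_int (fst q) / real n \<longleftrightarrow> fst q\<^sub>0 + fst q\<^sub>2 < 2 * fst q)"
    proof (cases "\<gamma> \<le> 0")
      case True
      define \<theta> where "\<theta> = - \<gamma> / \<beta>"
      have th: "0 \<le> \<theta>" "\<theta> < \<delta>"
        unfolding \<theta>_def pos_divide_less_eq[OF \<alpha>\<beta>_pos(2)]
        using True \<alpha>\<beta>_pos \<gamma>' \<delta>\<beta> by (auto intro!: divide_nonpos_pos)
      define t\<^sub>0 where "t\<^sub>0 = \<tau> + \<theta> * l\<^sub>2"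
      have t0: "\<tau> \<le> t\<^sub>0" "t\<^sub>0 < b" "(t\<^sub>0 - \<tau>) / l\<^sub>2 = \<theta>" using th l by (auto simp: t\<^sub>0_def b_def)
      have f0: "f t\<^sub>0 = 0" using fr[of t\<^sub>0] t0 \<alpha>\<beta>_pos by (simp add: \<theta>_def)
      then have "snd (x t\<^sub>0) = of_int (snd q)" using e1 by (auto simp: f_def)
      then show ?thesis
        using pass_side[OF legs' legs(2) e bend mem normal xr[of t\<^sub>0]] t0 ab f0
        by (intro exI[of _ t\<^sub>0]) auto
    next
      case False
      define \<theta> where "\<theta> = \<gamma> / \<alpha>"
      have th: "0 \<le> \<theta>" "\<theta> < \<delta>"
        unfolding \<theta>_def pos_divide_less_eq[OF \<alpha>\<beta>_pos(1)]
        using False \<alpha>\<beta>_pos \<gamma>' \<delta>\<alpha> by (auto intro!: divide_nonneg_pos)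
      define t\<^sub>0 where "t\<^sub>0 = \<tau> - \<theta> * l\<^sub>1"
      have t0: "t\<^sub>0 \<le> \<tau>" "a < t\<^sub>0" "(\<tau> - t\<^sub>0) / l\<^sub>1 = \<theta>" using th l by (auto simp: t\<^sub>0_def a_def)
      have f0: "f t\<^sub>0 = 0" using fl[of t\<^sub>0] t0 \<alpha>\<beta>_pos by (simp add: \<theta>_def)
      then have sz: "snd (x t\<^sub>0) = of_int (snd q)" using e1 by (auto simp: f_def)
      have e2: "snd q\<^sub>0 = snd q + - \<epsilon>" "snd q\<^sub>2 = snd q - - \<epsilon>" "- \<epsilon> = 1 \<or> - \<epsilon> = -1"
        using e by auto
      have bend': "fst q\<^sub>2 + fst q\<^sub>0 \<noteq> 2 * fst q" using bend by simp
      show ?thesis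
        using pass_side[OF legs(2) legs' e2 bend' mem(2,1,3) normal(1) normal' xl[of t\<^sub>0] sz] t0 ab f0
        by (intro exI[of _ t\<^sub>0]) (auto simp: add.commute)
    qed
    then obtain t\<^sub>0 where t0: "a < t\<^sub>0" "t\<^sub>0 < b" "f t\<^sub>0 = 0"
      and side: "fst q\<^sub>0 + fst q\<^sub>2 < 2 * fst q \<longleftrightarrow> fst (x t\<^sub>0) < of_int (fst q) / real n" by blast
    define i where "i = nat (fst q mod int n) + (if fst q\<^sub>0 + fst q\<^sub>2 < 2 * fst q then 0 else 1)"
    have sz: "snd (x t\<^sub>0) = of_int (snd q)" using t0(3) e1 by (auto simp: f_def)
    have ndvd: "\<not> int n dvd fst q" using legs(2) by (simp add: leg_def)
    have "x t\<^sub>0 \<notin> ball (center n q) r" using avoid[of t\<^sub>0] t0 ab by simp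
    note wall = wall_b_adjacent[OF ndvd _ sz this side i_def]
    have "if \<epsilon> = 1 then crosses_up (\<lambda>s. snd (x s)) t\<^sub>0 else crosses_down (\<lambda>s. snd (x s)) t\<^sub>0"
      using mono t0 e(3) unfolding f_def e_def by (intro strict_mono_on_crosses) auto
    moreover have "\<epsilon> = 1 \<longleftrightarrow> snd q\<^sub>0 < snd q\<^sub>2" using e by auto
    ultimately have "wall_crossing n r x t\<^sub>0 (Gen_b i, snd q\<^sub>0 < snd q\<^sub>2)"
      using wall near[of t\<^sub>0] t0 by auto
    moreover have "fst (x t) \<notin> \<int> \<and> snd (x t) \<notin> \<int>" if t: "a < t" "t < b" "t \<noteq> t\<^sub>0" for t
    proof
      show "fst (x t) \<notin> \<int>" using near[of t] t by simp
      have "f t \<noteq> 0"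
        using strict_mono_onD[OF mono, of t t\<^sub>0] strict_mono_onD[OF mono, of t\<^sub>0 t] t t0
        by (cases "t < t\<^sub>0") auto
      then have "snd (x t) \<noteq> of_int (snd q)" by (auto simp: f_def)
      then show "snd (x t) \<notin> \<int>"
        using near[of t] t not_Ints_between[of "snd q" "snd (x t)"]
          not_Ints_between[of "snd q - 1" "snd (x t)"] by (cases "snd (x t) < of_int (snd q)") auto
    qed
    ultimately have "crossing_word_on n r x a b [(Gen_b i, snd q\<^sub>0 < snd q\<^sub>2)]"
      using t0 by (intro crossing_word_on_single[of _ t\<^sub>0]) auto
    then show ?thesis using False by (simp add: turn_word_def a_def b_def i_def)
  qed
qed

fun route_word :: "(int \<times> int) list \<Rightarrow> letter list" where
  "route_word (q # q' # qs) =
     leg_word q q' @ (case qs of [] \<Rightarrow> [] | q'' # _ \<Rightarrow> turn_word q q' q'') @ route_word (q' # qs)"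
| "route_word _ = []"

fun route :: "(int \<times> int) list \<Rightarrow> bool" where
  "route (q # q' # qs) \<longleftrightarrow>
     leg q q' \<and> (case qs of [] \<Rightarrow> True | q'' # _ \<Rightarrow> turn q q' q'') \<and> route (q' # qs)"
| "route _ \<longleftrightarrow> True"

lemma route_nth:
  assumes "route qs"
  shows "Suc i < length qs \<Longrightarrow> leg (qs ! i) (qs ! Suc i)"
    and "Suc (Suc i) < length qs \<Longrightarrow> turn (qs ! i) (qs ! Suc i) (qs ! Suc (Suc i))"
  using assms
proof (induction qs arbitrary: i rule: route.induct)
  case (1 q q' qs)
  { case 1 then show ?case using "1.IH"(1)[of "i - 1"] by (cases i) auto }
  { case 2 then show ?case using "1.IH"(2)[of "i - 1"] by (cases i) (auto split: list.splits) }
qed auto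

text \<open>
  The words of the pieces are concatenated from the end of the chain backwards, which matches the
  recursion of \<open>route_word\<close>.
\<close>
lemma taut_chain_crossing_word:
  assumes N: "0 < N"
    and legs: "\<And>i. i < N \<Longrightarrow> leg (\<sigma> i) (\<sigma> (Suc i))"
    and turns: "\<And>i. Suc i < N \<Longrightarrow> turn (\<sigma> i) (\<sigma> (Suc i)) (\<sigma> (Suc (Suc i)))"
    and taut: "taut_chain N \<sigma> p"
    and table: "\<And>t. 0 \<le> t \<Longrightarrow> t \<le> chain_length N p \<Longrightarrow> x t \<in> table n r"
    and path: "\<And>i t. i < N \<Longrightarrow> chain_length i p \<le> t \<Longrightarrow> t \<le> chain_length (Suc i) p \<Longrightarrow>
           x t = p i + (t - chain_length i p) *\<^sub>R sgn (p (Suc i) - p i)"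
  shows "crossing_word n r (chain_length N p) x (route_word (map \<sigma> [0..<Suc N]))"
proof -
  have normal: "\<exists>\<mu>>0. p i - center n (\<sigma> i) =
           \<mu> *\<^sub>R (sgn (p (if i = 0 then 1 else i - 1) - p i) + sgn (p (Suc i) - p i))"
    if "i \<le> N" for i
    using taut that by (auto simp: taut_chain_def)
  define \<tau> where "\<tau> i = chain_length i p" for i
  define l where "l i = dist (p i) (p (Suc i))" for i
  have \<tau>S: "\<tau> (Suc i) = \<tau> i + l i" for i by (simp add: \<tau>_def l_def)
  have \<tau>0: "\<tau> 0 = 0" by (simp add: \<tau>_def)
  have \<tau>_mono: "\<tau> i \<le> \<tau> j" if "i \<le> j" for i j using that by (simp add: \<tau>_def chain_length_mono)
  have mem: "p i \<in> disk (\<sigma> i)" if "i \<le> N" for i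
    using taut that by (auto simp: taut_chain_def dist_norm norm_minus_commute)
  have l_pos: "0 < l i" if "i \<le> N" for i using taut that by (auto simp: taut_chain_def l_def)
  have x_fwd: "x t = p i + ((t - \<tau> i) / l i) *\<^sub>R (p (Suc i) - p i)"
    if "i < N" "\<tau> i \<le> t" "t \<le> \<tau> i + l i" for i t
    using path[of i t] that l_pos[of i]
    by (simp add: \<tau>_def l_def sgn_div_norm dist_norm norm_minus_commute divide_inverse)
  have x_bwd: "x t = p (Suc i) + ((\<tau> (Suc i) - t) / l i) *\<^sub>R (p i - p (Suc i))"
    if i: "i < N" "\<tau> (Suc i) - l i \<le> t" "t \<le> \<tau> (Suc i)" for i t
  proof -
    have "x t = p i + ((t - \<tau> i) / l i) *\<^sub>R (p (Suc i) - p i)"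
      using i by (intro x_fwd) (auto simp: \<tau>S)
    also have "(t - \<tau> i) / l i = 1 - (\<tau> (Suc i) - t) / l i"
      using l_pos[of i] i by (simp add: \<tau>S field_simps)
    finally show ?thesis by (simp add: algebra_simps)
  qed
  define a b where "a i = \<tau> i + \<delta> * l i" and "b i = \<tau> i + (1 - \<delta>) * l i" for i
  have b_alt: "b i = \<tau> (Suc i) - \<delta> * l i" for i by (simp add: b_def \<tau>S algebra_simps)
  have order: "\<tau> i < a i" "a i < b i" "b i < \<tau> (Suc i)" if "i < N" for i
  proof -
    have "0 < \<delta> * l i" "\<delta> * l i < (1 / 2) * l i"
      using \<delta>_pos \<delta>_less l_pos[of i] that by (auto intro!: mult_strict_right_mono)
    then show "\<tau> i < a i" "a i < b i" "b i < \<tau> (Suc i)"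
      by (auto simp: a_def b_def \<tau>S algebra_simps)
  qed
  have middle: "crossing_word_on n r x (a i) (b i) (leg_word (\<sigma> i) (\<sigma> (Suc i)))" if "i < N" for i
    unfolding a_def b_def
    by (rule leg_middle_word[OF legs mem mem l_pos x_fwd]) (use that in auto)
  have a_off: "\<not> wall_crossing n r x (a i) c" if i: "i < N" for i c
  proof -
    have xa: "x (a i) = p i + \<delta> *\<^sub>R (p (Suc i) - p i)"
      using x_fwd[of i "a i"] order[of i] l_pos[of i] \<delta>_less i by (simp add: a_def \<tau>S)
    have "fst (x (a i)) \<notin> \<int>"
      using near_vertex(3)[OF legs mem mem _ _ xa] i \<delta>_pos by auto
    moreover have "snd (x (a i)) \<notin> \<int>"
      using leg_middle_height(2)[OF legs mem mem _ _ xa] i \<delta>_less by auto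
    ultimately show ?thesis using wall_crossing_coords by blast
  qed
  have b_off: "\<not> wall_crossing n r x (b i) c" if i: "i < N" for i c
  proof -
    have xb: "x (b i) = p (Suc i) + \<delta> *\<^sub>R (p i - p (Suc i))"
      using x_bwd[of i "b i"] order[of i] l_pos[of i] \<delta>_less i by (simp add: b_alt \<tau>S)
    have leg': "leg (\<sigma> (Suc i)) (\<sigma> i)" using legs[OF i] by (simp add: leg_commute)
    have "fst (x (b i)) \<notin> \<int>"
      using near_vertex(3)[OF leg' mem mem _ _ xb] i \<delta>_pos by auto
    moreover have "snd (x (b i)) \<notin> \<int>"
      using leg_middle_height(2)[OF leg' mem mem _ _ xb] i \<delta>_less by auto
    ultimately show ?thesis using wall_crossing_coords by blast
  qed
  have node: "crossing_word_on n r x (b i) (a (Suc i)) (turn_word (\<sigma> i) (\<sigma> (Suc i)) (\<sigma> (Suc (Suc i))))"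
    if i: "Suc i < N" for i
  proof -
    obtain \<mu> where \<mu>: "\<mu> > 0" "p (Suc i) - center n (\<sigma> (Suc i)) =
        \<mu> *\<^sub>R (sgn (p i - p (Suc i)) + sgn (p (Suc (Suc i)) - p (Suc i)))"
      using normal[of "Suc i"] i by auto
    show ?thesis
      unfolding b_alt a_def
    proof (rule turn_crossing_word[OF _ _ _ mem mem mem \<mu> l_pos l_pos x_bwd x_fwd])
      fix t assume t: "\<tau> (Suc i) - l i \<le> t" "t \<le> \<tau> (Suc i) + l (Suc i)"
      have "0 \<le> t" "t \<le> \<tau> N"
        using t \<tau>_mono[of 0 i] \<tau>_mono[of "Suc (Suc i)" N] i \<tau>0 by (auto simp: \<tau>S)
      then have "x t \<in> table n r" using table[of t] by (simp add: \<tau>_def)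
      then show "x t \<notin> ball (center n (\<sigma> (Suc i))) r"
        unfolding table_def obstacle_def by blast
    qed (use i legs[of i] legs[of "Suc i"] turns[of i] in auto)
  qed
  have start: "crossing_word_on n r x 0 (a 0) []"
  proof (rule crossing_word_on_Nil)
    fix t assume t: "0 < t" "t < a 0"
    obtain \<mu> where \<mu>: "\<mu> > 0" "p 0 - center n (\<sigma> 0) = \<mu> *\<^sub>R (sgn (p 1 - p 0) + sgn (p 1 - p 0))"
      using normal[of 0] by auto
    have "x t = p 0 + (t / l 0) *\<^sub>R (p 1 - p 0)"
      using x_fwd[of 0 t] t order[of 0] N \<tau>0 by (simp add: \<tau>S)
    moreover have "0 \<le> t / l 0" "t / l 0 \<le> \<delta>"
      using t l_pos[of 0] by (auto simp: a_def \<tau>0 field_simps)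
    ultimately show "fst (x t) \<notin> \<int> \<and> snd (x t) \<notin> \<int>"
      using legs[of 0] mem[of 0] mem[of 1] \<mu> N
      by (intro bounce_stays_off_walls[of "\<sigma> 0" "\<sigma> 1" "\<sigma> 1" "p 1" "p 1" "p 0" \<mu> "t / l 0"]) simp_all
  qed
  have finish: "crossing_word_on n r x (b (N - 1)) (\<tau> N) []"
  proof (rule crossing_word_on_Nil)
    fix t assume t: "b (N - 1) < t" "t < \<tau> N"
    define M where "M = N - 1"
    have M: "N = Suc M" using N by (simp add: M_def)
    have "p (Suc N) = p M" using taut by (simp add: taut_chain_def M)
    then obtain \<mu> where \<mu>: "\<mu> > 0"
      "p N - center n (\<sigma> N) = \<mu> *\<^sub>R (sgn (p M - p N) + sgn (p M - p N))"
      using normal[of N] M by auto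
    have bM: "b M = \<tau> N - \<delta> * l M" by (simp add: b_alt M)
    have "x t = p N + ((\<tau> N - t) / l M) *\<^sub>R (p M - p N)"
      using x_bwd[of M t] t order[of M] by (simp add: M \<tau>S)
    moreover have "0 \<le> (\<tau> N - t) / l M" "(\<tau> N - t) / l M \<le> \<delta>"
      using t l_pos[of M] bM by (auto simp: M M_def[symmetric] field_simps)
    moreover have "leg (\<sigma> N) (\<sigma> M)" using legs[of M] by (simp add: M leg_commute)
    ultimately show "fst (x t) \<notin> \<int> \<and> snd (x t) \<notin> \<int>"
      using mem[of M] mem[of N] \<mu> M
      by (intro bounce_stays_off_walls[of "\<sigma> N" "\<sigma> M" "\<sigma> M" "p M" "p M" "p N" \<mu> "(\<tau> N - t) / l M"]) simp_all
  qed
  have "crossing_word_on n r x (a i) (\<tau> N) (route_word (map \<sigma> [i..<Suc N]))" if "i \<le> N - 1" for i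
    using that
  proof (induction i rule: inc_induct)
    case base
    have "crossing_word_on n r x (a (N - 1)) (\<tau> N) (leg_word (\<sigma> (N - 1)) (\<sigma> (Suc (N - 1))) @ [])"
      using middle[of "N - 1"] finish order[of "N - 1"] b_off[of "N - 1"] N
      by (intro crossing_word_on_append) auto
    moreover have "map \<sigma> [N - 1..<Suc N] = [\<sigma> (N - 1), \<sigma> (Suc (N - 1))]"
      using N by (simp add: upt_rec)
    ultimately show ?case by simp
  next
    case (step i)
    have i: "Suc i < N" using step by auto
    have \<tau>N: "\<tau> (Suc (Suc i)) \<le> \<tau> N" using i \<tau>_mono by simp
    have "crossing_word_on n r x (b i) (\<tau> N)
        (turn_word (\<sigma> i) (\<sigma> (Suc i)) (\<sigma> (Suc (Suc i))) @ route_word (map \<sigma> [Suc i..<Suc N]))"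
      by (rule crossing_word_on_append[OF node[OF i] step.IH])
        (use order[of i] order[of "Suc i"] a_off[of "Suc i"] i \<tau>N in auto)
    from crossing_word_on_append[OF middle this]
    have "crossing_word_on n r x (a i) (\<tau> N) (leg_word (\<sigma> i) (\<sigma> (Suc i)) @
        (turn_word (\<sigma> i) (\<sigma> (Suc i)) (\<sigma> (Suc (Suc i))) @ route_word (map \<sigma> [Suc i..<Suc N])))"
      using order[of i] order[of "Suc i"] b_off[of i] i \<tau>N by auto
    moreover have "map \<sigma> [i..<Suc N] = \<sigma> i # \<sigma> (Suc i) # \<sigma> (Suc (Suc i)) # map \<sigma> [Suc (Suc (Suc i))..<Suc N]"
      "map \<sigma> [Suc i..<Suc N] = \<sigma> (Suc i) # \<sigma> (Suc (Suc i)) # map \<sigma> [Suc (Suc (Suc i))..<Suc N]"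
      using i by (simp_all add: upt_conv_Cons del: upt_Suc)
    ultimately show ?case by simp
  qed
  then have "crossing_word_on n r x 0 (\<tau> N) ([] @ route_word (map \<sigma> [0..<Suc N]))"
    using a_off[of 0] order[of 0] \<tau>_mono[of 1 N] N \<tau>0
    by (intro crossing_word_on_append[OF start]) (auto simp del: upt_Suc)
  then show ?thesis by (simp add: crossing_word_iff \<tau>_def)
qed

section \<open>Trajectories along routes\<close>

text \<open>
  The length of a shortest chain is the duration of the trajectory along the route. As an infimum it is
  easily compared for different routes.
\<close>
definition route_length :: "(int \<times> int) list \<Rightarrow> real" where
  "route_length qs =
     (INF p \<in> {p. \<forall>i<length qs. p i \<in> disk (qs ! i)}. chain_length (length qs - 1) p)"

lemma route_length_le:
  assumes "\<And>i. i < length qs \<Longrightarrow> p i \<in> disk (qs ! i)"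
  shows "route_length qs \<le> chain_length (length qs - 1) p"
  unfolding route_length_def
  by (rule cINF_lower) (use assms in \<open>auto intro!: bdd_belowI2[where m = 0] chain_length_nonneg\<close>)

lemma route_length_ge:
  assumes "\<And>p. (\<And>i. i < length qs \<Longrightarrow> p i \<in> disk (qs ! i)) \<Longrightarrow> c \<le> chain_length (length qs - 1) p"
  shows "c \<le> route_length qs"
  unfolding route_length_def
proof (rule cINF_greatest)
  show "{p. \<forall>i<length qs. p i \<in> disk (qs ! i)} \<noteq> {}"
    using r_pos by (auto intro!: exI[of _ "\<lambda>i. center n (qs ! i)"])
qed (use assms in auto)

lemma route_length_attained:
  assumes qs: "route qs" "2 \<le> length qs"
  obtains p where "taut_chain (length qs - 1) ((!) qs) p"
    "chain_length (length qs - 1) p = route_length qs"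
proof -
  define N where "N = length qs - 1"
  have N: "length qs = Suc N" "0 < N" using qs by (auto simp: N_def)
  obtain p where p: "taut_chain N ((!) qs) p"
    "\<And>q. (\<And>i. q i \<in> disk (qs ! i)) \<Longrightarrow> chain_length N p \<le> chain_length N q"
    by (rule taut_chain_exists[of N "(!) qs"]) (use N route_nth[OF qs(1)] in auto)
  have "chain_length N p \<le> route_length qs"
  proof (rule route_length_ge)
    fix q assume q: "\<And>i. i < length qs \<Longrightarrow> q i \<in> disk (qs ! i)"
    define q' where "q' i = (if i < length qs then q i else center n (qs ! i))" for i
    have "chain_length N p \<le> chain_length N q'"
      using q r_pos by (intro p(2)) (auto simp: q'_def)
    also have "\<dots> = chain_length N q" by (rule chain_length_cong) (auto simp: q'_def N)
    finally show "chain_length N p \<le> chain_length (length qs - 1) q" by (simp add: N)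
  qed
  moreover have "route_length qs \<le> chain_length N p"
    using route_length_le[of qs p] p(1) N
    by (auto simp: taut_chain_def dist_norm norm_minus_commute)
  ultimately show thesis using that[of p] p(1) by (simp add: N)
qed

lemma route_realized:
  assumes qs: "route qs" "2 \<le> length qs"
  obtains x v where "billiard_segment n r (route_length qs) x v"
    "admissible n r (route_length qs) x"
    "pi1_element n r (route_length qs) x (free_reduce (route_word qs))"
proof -
  define N where "N = length qs - 1"
  have N: "length qs = Suc N" "0 < N" using qs by (auto simp: N_def)
  have qs_map: "map ((!) qs) [0..<Suc N] = qs" using N map_nth[of qs] by simp
  have legs: "\<And>i. i < N \<Longrightarrow> leg (qs ! i) (qs ! Suc i)"
    and turns: "\<And>i. Suc i < N \<Longrightarrow> turn (qs ! i) (qs ! Suc i) (qs ! Suc (Suc i))"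
    using route_nth[OF qs(1)] N by auto
  obtain p where p: "taut_chain N ((!) qs) p" "chain_length N p = route_length qs"
    using route_length_attained[OF qs] by (auto simp: N_def)
  obtain x v where xv: "billiard_segment n r (chain_length N p) x v"
    "\<And>i t. i < N \<Longrightarrow> chain_length i p \<le> t \<Longrightarrow> t \<le> chain_length (Suc i) p \<Longrightarrow>
           x t = p i + (t - chain_length i p) *\<^sub>R sgn (p (Suc i) - p i)"
    "visits n r (chain_length N p) x (map ((!) qs) [0..<Suc N])"
    using taut_chain_billiard[OF N(2) legs p(1)] by blast
  have "crossing_word n r (chain_length N p) x (route_word (map ((!) qs) [0..<Suc N]))"
    by (rule taut_chain_crossing_word[OF N(2) legs turns p(1) _ xv(2)])
      (use xv(1) in \<open>auto simp: billiard_segment_def\<close>)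
  moreover have "admissible n r (chain_length N p) x"
    unfolding admissible_def using xv(3) admissible_itinerary_route[of N "(!) qs", OF legs turns] by blast
  ultimately show thesis
    using that[of x v] xv(1) unfolding p(2) qs_map pi1_element_def by blast
qed

text \<open>
  An initial part of a chain for the longer route is a chain for the shorter one; conversely a shortest
  chain can be prolonged to the center of the new disk.
\<close>
lemma route_length_append:
  assumes qs: "route qs" "2 \<le> length qs"
  shows "route_length qs \<le> route_length (qs @ [q])"
    and "route_length (qs @ [q]) \<le> route_length qs + dist (center n (last qs)) (center n q) + r"
proof -
  define N where "N = length qs - 1"
  have N: "length qs = Suc N" "0 < N" using qs by (auto simp: N_def)
  show "route_length qs \<le> route_length (qs @ [q])"
  proof (rule route_length_ge)
    fix p assume p: "\<And>i. i < length (qs @ [q]) \<Longrightarrow> p i \<in> disk ((qs @ [q]) ! i)"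
    have "p i \<in> disk (qs ! i)" if "i < length qs" for i
      using p[of i] that by (simp add: nth_append)
    then have "route_length qs \<le> chain_length (length qs - 1) p" by (rule route_length_le)
    also have "\<dots> \<le> chain_length (length (qs @ [q]) - 1) p" by (rule chain_length_mono) simp
    finally show "route_length qs \<le> chain_length (length (qs @ [q]) - 1) p" .
  qed
  obtain p where p: "taut_chain N ((!) qs) p" "chain_length N p = route_length qs"
    using route_length_attained[OF qs] by (auto simp: N_def)
  have mem: "p i \<in> disk (qs ! i)" if "i \<le> N" for i
    using p(1) that by (auto simp: taut_chain_def dist_norm norm_minus_commute)
  define p' where "p' = p(Suc N := center n q)"
  have "route_length (qs @ [q]) \<le> chain_length (length (qs @ [q]) - 1) p'"
    using mem r_pos by (intro route_length_le) (auto simp: p'_def N nth_append less_Suc_eq)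
  also have "\<dots> = chain_length N p' + dist (p N) (center n q)"
    by (simp add: N p'_def)
  also have "chain_length N p' = route_length qs"
    unfolding p(2)[symmetric] by (rule chain_length_cong) (auto simp: p'_def)
  also have "dist (p N) (center n q) \<le> dist (center n (last qs)) (center n q) + r"
  proof -
    have "last qs = qs ! N" using N last_conv_nth[of qs] by (cases "qs = []") auto
    then have "dist (p N) (center n (last qs)) \<le> r" using mem[of N] by (simp add: dist_commute)
    then show ?thesis using dist_triangle[of "p N" "center n q" "center n (last qs)"] by linarith
  qed
  finally show "route_length (qs @ [q]) \<le> route_length qs + dist (center n (last qs)) (center n q) + r"
    by simp
qed

lemma route_length_bounds:
  assumes qs: "route qs" "2 \<le> length qs"
  shows "real (length qs - 1) / 2 \<le> route_length qs" "route_length qs \<le> 3 * real (length qs)"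
proof -
  have legs: "leg (qs ! i) (qs ! Suc i)" if "i < length qs - 1" for i
    using route_nth(1)[OF qs(1), of i] that by simp
  obtain p where p: "taut_chain (length qs - 1) ((!) qs) p"
    "chain_length (length qs - 1) p = route_length qs"
    using route_length_attained[OF qs] by blast
  have mem: "p i \<in> disk (qs ! i)" if "i \<le> length qs - 1" for i
    using p(1) that by (auto simp: taut_chain_def dist_norm norm_minus_commute)
  have "1 / 2 \<le> dist (p i) (p (Suc i))" if i: "i < length qs - 1" for i
  proof -
    obtain \<epsilon> where e: "snd (qs ! Suc i) = snd (qs ! i) + \<epsilon>" "\<epsilon> = 1 \<or> \<epsilon> = -1"
      by (rule leg_cases[OF legs[OF i]])
    have "1 - 2 * r \<le> \<bar>snd (p i) - snd (p (Suc i))\<bar>"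
      using leg_rise(2)[OF legs[OF i] mem mem e] e(2) i by auto
    then show ?thesis
      using dist_snd_le[of "p i" "p (Suc i)"] r_less_300th by (simp add: dist_real_def)
  qed
  then have "real (length qs - 1) * (1 / 2) \<le> chain_length (length qs - 1) p"
    by (rule chain_length_ge)
  then show "real (length qs - 1) / 2 \<le> route_length qs" unfolding p(2)[symmetric] by simp
  define c where "c i = center n (qs ! i)" for i
  have "dist (c i) (c (Suc i)) \<le> 3" if i: "i < length qs - 1" for i
  proof -
    have "\<bar>fst (qs ! Suc i) - fst (qs ! i)\<bar> \<le> 2 * int n" "\<bar>snd (qs ! Suc i) - snd (qs ! i)\<bar> = 1"
      using legs[OF i] by (auto simp: leg_def)
    then have "\<bar>of_int (fst (qs ! i) - fst (qs ! Suc i))\<bar> \<le> 2 * real n"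
      "\<bar>snd (c i) - snd (c (Suc i))\<bar> = 1" by (simp_all add: c_def center_def)
    moreover from this(1) have "\<bar>fst (c i) - fst (c (Suc i))\<bar> \<le> 2"
      using n_pos by (simp add: c_def center_def field_simps flip: diff_divide_distrib)
    ultimately show ?thesis using dist_plane_le[of "c i" "c (Suc i)"] by linarith
  qed
  then have "chain_length (length qs - 1) c \<le> real (length qs - 1) * 3"
    by (rule chain_length_le)
  moreover have "route_length qs \<le> chain_length (length qs - 1) c"
    using r_pos by (intro route_length_le) (auto simp: c_def)
  ultimately show "route_length qs \<le> 3 * real (length qs)" by simp
qed

end

section \<open>Free reduction\<close>

definition reduced_word :: "letter list \<Rightarrow> bool" where
  "reduced_word = successively (\<lambda>l l'. l' \<noteq> inv_letter l)"

lemma inv_letter_inv_letter [simp]: "inv_letter (inv_letter l) = l"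
  by (simp add: inv_letter_def prod_eq_iff)

lemma reduced_Cons_Cons [simp]: "reduced_word (l # l' # w) \<longleftrightarrow> l' \<noteq> inv_letter l \<and> reduced_word (l' # w)"
  by (simp add: reduced_word_def)

lemma reduced_Nil [simp]: "reduced_word []"
  by (simp add: reduced_word_def)

lemma reduced_single [simp]: "reduced_word [l]"
  by (simp add: reduced_word_def)

lemma reduced_ConsD: "reduced_word (l # w) \<Longrightarrow> reduced_word w"
  by (cases w) auto

lemma cons_reduce_reduced_Cons: "reduced_word (l # w) \<Longrightarrow> cons_reduce l w = l # w"
  by (cases w) auto

lemma reduced_cons_reduce: "reduced_word w \<Longrightarrow> reduced_word (cons_reduce l w)"
  by (cases w) (auto dest: reduced_ConsD)

lemma reduced_foldr_cons_reduce: "reduced_word w \<Longrightarrow> reduced_word (foldr cons_reduce u w)"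
  by (induction u) (auto intro: reduced_cons_reduce)

lemma cons_reduce_cancel:
  assumes "reduced_word w"
  shows "cons_reduce l (cons_reduce (inv_letter l) w) = w"
proof (cases w)
  case (Cons l' w')
  then show ?thesis using assms cons_reduce_reduced_Cons[of l w'] by auto
qed simp

lemma foldr_cons_reduce_reduced: "reduced_word (u @ w) \<Longrightarrow> foldr cons_reduce u w = u @ w"
proof (induction u)
  case (Cons l u)
  then show ?case using cons_reduce_reduced_Cons[of l "u @ w"] reduced_ConsD[of l "u @ w"] by simp
qed simp

lemma free_reduce_reduced: "reduced_word w \<Longrightarrow> free_reduce w = w"
  using foldr_cons_reduce_reduced[of w "[]"] by (simp add: free_reduce_def)

lemma free_reduce_append: "free_reduce (u @ w) = foldr cons_reduce u (free_reduce w)"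
  by (simp add: free_reduce_def)

lemma reduced_free_reduce: "reduced_word (free_reduce w)"
  unfolding free_reduce_def by (intro reduced_foldr_cons_reduce) simp

context small_disks
begin

section \<open>Routes with prescribed words\<close>

text \<open>
  The letters of legs and turns depend on column and residue rather than on the abscissa itself, and a
  residue \<open>m\<close> strictly between 0 and \<open>n\<close> keeps the disk off the vertical walls.
\<close>
definition disk_at :: "int \<Rightarrow> int \<Rightarrow> int \<Rightarrow> int \<times> int" where
  "disk_at m c k = (c * int n + m, k)"

lemma disk_at_simps [simp]:
  "snd (disk_at m c k) = k"
  "0 < m \<Longrightarrow> m < int n \<Longrightarrow> fst (disk_at m c k) div int n = c"
  "0 < m \<Longrightarrow> m < int n \<Longrightarrow> fst (disk_at m c k) mod int n = m"
  by (auto simp: disk_at_def)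

lemma leg_disk_at:
  assumes "0 < m" "m < int n" "0 < m'" "m' < int n" "\<bar>c' - c\<bar> \<le> 1" "\<bar>k' - k\<bar> = 1"
  shows "leg (disk_at m c k) (disk_at m' c' k')"
proof -
  have "c' - c = 0 \<or> c' - c = 1 \<or> c' - c = -1" using assms(5) by linarith
  moreover have "fst (disk_at m' c' k') - fst (disk_at m c k) = (c' - c) * int n + (m' - m)"
    by (simp add: disk_at_def algebra_simps)
  ultimately have "\<bar>fst (disk_at m' c' k') - fst (disk_at m c k)\<bar> \<le> 2 * int n"
    using assms by auto
  then show ?thesis using assms by (simp add: leg_def dvd_eq_mod_eq_0)
qed

abbreviation home :: "int \<Rightarrow> int \<Rightarrow> int \<times> int" where
  "home \<equiv> disk_at 1"

text \<open>
  The wall \<open>b\<^sub>i\<close> is crossed by passing the disk \<open>i\<close> on its left or, for \<open>i = n\<close>, the disk \<open>n - 1\<close> on its right.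
  The bend to the proper side is enforced by an excursion into the neighbouring column,
  to the disk \<open>aside\<close>. It costs a letter \<open>a\<close> and its inverse next to each other, which cancel.
\<close>
definition gate_disk :: "nat \<Rightarrow> int \<Rightarrow> int \<Rightarrow> int \<times> int" where
  "gate_disk i c k = (if i < n then disk_at (int i) c k else disk_at (int n - 1) c k)"

definition aside :: "nat \<Rightarrow> int \<Rightarrow> int \<Rightarrow> int \<times> int" where
  "aside i c k = (if i < n then disk_at 1 (c - 1) k else disk_at (int n - 1) (c + 1) k)"

text \<open>
  All pieces start at a disk \<open>home\<close>, which the route enters from above and leaves upwards, and lead to the
  next such disk, \<open>letter_target\<close>, which is omitted from the list. So consecutive pieces are joined by a
  bounce, whatever the letters are.
\<close>
fun letter_route :: "letter \<Rightarrow> int \<Rightarrow> int \<Rightarrow> (int \<times> int) list" where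
  "letter_route (Gen_a, s) c k = [home c k, home (if s then c + 1 else c - 1) (k + 1)]"
| "letter_route (Gen_b i, s) c k =
     (if s then [home c k, gate_disk i c (k + 1), aside i c (k + 2)]
      else [home c k, aside i c (k + 1), gate_disk i c k])"

fun letter_target :: "letter \<Rightarrow> int \<times> int \<Rightarrow> int \<times> int" where
  "letter_target (Gen_a, s) (c, k) = (if s then (c + 1, k) else (c - 1, k))"
| "letter_target (Gen_b i, s) (c, k) = (if s then (c, k + 1) else (c, k - 1))"

definition opens_upward :: "int \<Rightarrow> int \<Rightarrow> (int \<times> int) list \<Rightarrow> bool" where
  "opens_upward c k qs \<longleftrightarrow> (\<exists>q qs'. qs = home c k # q # qs' \<and> snd q = k + 1)"

lemma gate_legs:
  assumes "1 \<le> i" "i \<le> n" "\<bar>k' - k\<bar> = 1"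
  shows "leg (home c k) (gate_disk i c k')" "leg (gate_disk i c k) (home c k')"
    "leg (gate_disk i c k) (aside i c k')" "leg (aside i c k) (gate_disk i c k')"
    "leg (aside i c k) (home c k')" "leg (home c k) (aside i c k')"
  using assms n3 by (auto simp: gate_disk_def aside_def intro!: leg_disk_at)

lemma gate_words:
  assumes i: "1 \<le> i" "i \<le> n"
  shows "leg_word (home c k) (gate_disk i c k') = []" "leg_word (gate_disk i c k) (home c k') = []"
    "leg_word (gate_disk i c k) (aside i c k') = [(Gen_a, \<not> i < n)]"
    "leg_word (aside i c k) (gate_disk i c k') = [(Gen_a, i < n)]"
    "leg_word (home c k) (aside i c k') = [(Gen_a, \<not> i < n)]"
    "leg_word (aside i c k) (home c k') = [(Gen_a, i < n)]"
  using assms n3 by (auto simp: gate_disk_def aside_def leg_word_def)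

lemma gate_side:
  assumes i: "1 \<le> i" "i \<le> n"
  shows "fst (home c k) + fst (aside i c k') < 2 * fst (gate_disk i c k'') \<longleftrightarrow> i < n"
    "fst (home c k) + fst (aside i c k') \<noteq> 2 * fst (gate_disk i c k'')"
  using assms n3 by (auto simp: gate_disk_def aside_def disk_at_def algebra_simps)

lemma gate_turn:
  assumes i: "1 \<le> i" "i \<le> n"
  shows "turn (home c k) (gate_disk i c k') (aside i c k'')"
    "turn (aside i c k) (gate_disk i c k') (home c k'')"
  using gate_side(2)[OF i] by (auto simp: turn_def add.commute)

lemma gate_turn_word:
  assumes i: "1 \<le> i" "i \<le> n"
  shows "k < k'' \<Longrightarrow> turn_word (home c k) (gate_disk i c k') (aside i c k'') = [(Gen_b i, True)]"
    "k'' < k \<Longrightarrow> turn_word (aside i c k) (gate_disk i c k') (home c k'') = [(Gen_b i, False)]"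
proof -
  have res: "nat (fst (gate_disk i c k') mod int n) + (if i < n then 0 else 1) = i"
    using i n3 by (auto simp: gate_disk_def nat_diff_distrib)
  have rows: "snd (home c k) = k" "snd (aside i c k) = k" "snd (aside i c k'') = k''" by (auto simp: aside_def)
  show "turn_word (home c k) (gate_disk i c k') (aside i c k'') = [(Gen_b i, True)]" if "k < k''"
    using that rows res unfolding turn_word_def gate_side(1)[OF i] by simp
  have side: "fst (aside i c k) + fst (home c k'') < 2 * fst (gate_disk i c k') \<longleftrightarrow> i < n"
    using gate_side(1)[OF i] by (simp add: add.commute)
  show "turn_word (aside i c k) (gate_disk i c k') (home c k'') = [(Gen_b i, False)]" if "k'' < k"
    using that rows res unfolding turn_word_def side by simp
qed

lemma snd_gate [simp]: "snd (gate_disk i c k) = k" "snd (aside i c k) = k"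
  by (auto simp: gate_disk_def aside_def)

lemma same_row_turn: "snd q = snd q'' \<Longrightarrow> turn q q' q''" "snd q = snd q'' \<Longrightarrow> turn_word q q' q'' = []"
  by (auto simp: turn_def turn_word_def)

lemma letter_route_prepend:
  assumes l: "l \<in> letters n" and target: "letter_target l (c, k) = (c', k')"
    and qs: "route qs" "opens_upward c' k' qs"
  shows "route (letter_route l c k @ qs)" "opens_upward c k (letter_route l c k @ qs)"
    "free_reduce (route_word (letter_route l c k @ qs)) = cons_reduce l (free_reduce (route_word qs))"
proof -
  obtain t rest where S: "qs = home c' k' # t # rest" "snd t = k' + 1"
    using qs(2) by (auto simp: opens_upward_def)
  obtain g s where gs: "l = (g, s)" by (cases l)
  have cancel: "cons_reduce (x, y) (cons_reduce (x, z) (free_reduce w)) = free_reduce w"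
    if "z \<longleftrightarrow> \<not> y" for x y z w
    using cons_reduce_cancel[OF reduced_free_reduce, of "(x, y)" w] that by (simp add: inv_letter_def)
  have n1: "1 < int n" using n3 by simp
  have "route (letter_route l c k @ qs) \<and> opens_upward c k (letter_route l c k @ qs) \<and>
    free_reduce (route_word (letter_route l c k @ qs)) = cons_reduce l (free_reduce (route_word qs))"
  proof (cases g)
    case Gen_a
    define c1 where "c1 = (if s then c + 1 else c - 1)"
    have c': "c' = c1" "k' = k" using target by (auto simp: gs Gen_a c1_def split: if_splits)
    have legs: "leg (home c k) (home c1 (k + 1))" "leg (home c1 (k + 1)) (home c1 k)"
      using n1 by (auto simp: c1_def intro!: leg_disk_at)
    have words: "leg_word (home c k) (home c1 (k + 1)) = [(Gen_a, s)]"
      "leg_word (home c1 (k + 1)) (home c1 k) = []"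
      using n1 by (auto simp: leg_word_def c1_def)
    have "letter_route l c k @ qs = home c k # home c1 (k + 1) # home c1 k # t # rest"
      by (simp add: gs Gen_a S(1) c' c1_def)
    then show ?thesis
      using legs words qs(1) S same_row_turn
      by (simp add: opens_upward_def c' gs Gen_a free_reduce_append free_reduce_def[symmetric])
         (simp add: free_reduce_def)
  next
    case (Gen_b i)
    then have i: "1 \<le> i" "i \<le> n" using l by (auto simp: gs letters_def)
    show ?thesis
    proof (cases s)
      case True
      have c': "c' = c" "k' = k + 1" using target by (auto simp: gs Gen_b True)
      have "letter_route l c k @ qs = home c k # gate_disk i c (k + 1) # aside i c (k + 2) #
          home c (k + 1) # t # rest"
        by (simp add: gs Gen_b True S(1) c')
      then show ?thesis
        using qs(1) S same_row_turn gate_legs[OF i] gate_words[OF i] gate_turn[OF i] gate_turn_word[OF i]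
          cancel[of "i < n" "\<not> i < n" Gen_a "route_word (home c (k + 1) # t # rest)"]
        by (simp add: opens_upward_def c' gs Gen_b True) (simp add: free_reduce_def)
    next
      case False
      have c': "c' = c" "k' = k - 1" using target by (auto simp: gs Gen_b False)
      have "letter_route l c k @ qs = home c k # aside i c (k + 1) # gate_disk i c k #
          home c (k - 1) # t # rest"
        by (simp add: gs Gen_b False S(1) c')
      then show ?thesis
        using qs(1) S same_row_turn gate_legs[OF i] gate_words[OF i] gate_turn[OF i] gate_turn_word[OF i]
          cancel[of "i < n" "\<not> i < n" Gen_a "(Gen_b i, False) # route_word (home c (k - 1) # t # rest)"]
        by (simp add: opens_upward_def c' gs Gen_b False) (simp add: free_reduce_def)
    qed
  qed
  then show "route (letter_route l c k @ qs)" "opens_upward c k (letter_route l c k @ qs)"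
    "free_reduce (route_word (letter_route l c k @ qs)) = cons_reduce l (free_reduce (route_word qs))"
    by auto
qed

text \<open>
  The remainder \<open>qs'\<close> is kept arbitrary: the same initial part serves for all fast and slow
  continuations.
\<close>
lemma word_route_exists:
  assumes "set u \<subseteq> letters n"
  shows "\<exists>qs c' k'. \<forall>qs'. route qs' \<longrightarrow> opens_upward c' k' qs' \<longrightarrow>
      route (qs @ qs') \<and> opens_upward c k (qs @ qs') \<and>
      free_reduce (route_word (qs @ qs')) = foldr cons_reduce u (free_reduce (route_word qs'))"
  using assms
proof (induction u arbitrary: c k)
  case Nil
  show ?case by (rule exI[of _ "[]"], rule exI[of _ c], rule exI[of _ k]) simp
next
  case (Cons l u)
  obtain c1 k1 where t: "letter_target l (c, k) = (c1, k1)" by fastforce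
  obtain qs c' k' where qs: "\<And>qs'. route qs' \<Longrightarrow> opens_upward c' k' qs' \<Longrightarrow>
      route (qs @ qs') \<and> opens_upward c1 k1 (qs @ qs') \<and>
      free_reduce (route_word (qs @ qs')) = foldr cons_reduce u (free_reduce (route_word qs'))"
    using Cons.IH[of c1 k1] Cons.prems by auto
  show ?case
  proof (rule exI[of _ "letter_route l c k @ qs"], rule exI[of _ c'], rule exI[of _ k'], intro allI impI)
    fix qs' assume "route qs'" "opens_upward c' k' qs'"
    note q = qs[OF this]
    show "route ((letter_route l c k @ qs) @ qs') \<and> opens_upward c k ((letter_route l c k @ qs) @ qs') \<and>
      free_reduce (route_word ((letter_route l c k @ qs) @ qs')) =
      foldr cons_reduce (l # u) (free_reduce (route_word qs'))"
      using letter_route_prepend[OF _ t, of "qs @ qs'"] q Cons.prems by simp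
  qed
qed

text \<open>
  The fast part of a route climbs \<open>N + 1\<close> rows, alternating between the residues 1 and 2. The slow part
  bounces between the last two disks \<open>N\<close> and \<open>N + 1\<close> of the climb. Both residues are nonzero modulo \<open>n\<close>
  since \<open>n\<close> is at least 3. The disks with residue 2 are passed on the left and those with residue 1 on
  the right, so that every passage yields \<open>b\<^sub>2\<close>.
\<close>
definition zigzag_index :: "nat \<Rightarrow> nat \<Rightarrow> nat" where
  "zigzag_index N j = (if j \<le> N + 1 then j else if even (j - N) then N else N + 1)"

definition zigzag :: "int \<Rightarrow> int \<Rightarrow> nat \<Rightarrow> nat \<Rightarrow> int \<times> int" where
  "zigzag c k N j =
     (let i = zigzag_index N j in disk_at (if even i then 1 else 2) c (k + int i))"

lemma zigzag_index_step:
  "zigzag_index N (Suc j) = Suc (zigzag_index N j) \<or> zigzag_index N j = Suc (zigzag_index N (Suc j))"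
proof (cases "j \<le> N")
  case False
  then obtain d where "j = N + Suc d" using less_imp_Suc_add[of N j] by auto
  then show ?thesis by (simp add: zigzag_index_def)
qed (simp add: zigzag_index_def)

lemma zigzag_index_bounce:
  assumes "N \<le> j"
  shows "zigzag_index N (Suc (Suc j)) = zigzag_index N j"
proof -
  obtain d where "j = N + d" using assms le_Suc_ex by blast
  then show ?thesis by (auto simp: zigzag_index_def le_Suc_eq)
qed

abbreviation b\<^sub>2 :: letter where "b\<^sub>2 \<equiv> (Gen_b 2, True)"

lemma zigzag_leg:
  "leg (zigzag c k N j) (zigzag c k N (Suc j))"
  "leg_word (zigzag c k N j) (zigzag c k N (Suc j)) = []"
  "dist (center n (zigzag c k N j)) (center n (zigzag c k N (Suc j))) \<le> 4 / 3"
proof -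
  have n2: "2 < int n" using n3 by simp
  define i i' where "i = zigzag_index N j" and "i' = zigzag_index N (Suc j)"
  define m m' where "m = (if even i then 1 else 2 :: int)" and "m' = (if even i' then 1 else 2 :: int)"
  define k\<^sub>0 k\<^sub>1 where "k\<^sub>0 = k + int i" and "k\<^sub>1 = k + int i'"
  have z: "zigzag c k N j = disk_at m c k\<^sub>0" "zigzag c k N (Suc j) = disk_at m' c k\<^sub>1"
    "m \<in> {1, 2}" "m' \<in> {1, 2}" "\<bar>k\<^sub>1 - k\<^sub>0\<bar> = 1"
    using zigzag_index_step[of N j]
    by (auto simp: zigzag_def i_def[symmetric] i'_def[symmetric] m_def m'_def k\<^sub>0_def k\<^sub>1_def Let_def)
  show "leg (zigzag c k N j) (zigzag c k N (Suc j))"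
    unfolding z(1,2) using z(3-5) n2 by (intro leg_disk_at) auto
  show "leg_word (zigzag c k N j) (zigzag c k N (Suc j)) = []"
    unfolding z(1,2) using z(3-5) n2 by (auto simp: leg_word_def)
  have "dist (center n (disk_at m c k\<^sub>0)) (center n (disk_at m' c k\<^sub>1)) \<le>
      \<bar>of_int (m - m') / real n\<bar> + \<bar>of_int (k\<^sub>0 - k\<^sub>1)\<bar>"
    using dist_plane_le[of "center n (disk_at m c k\<^sub>0)" "center n (disk_at m' c k\<^sub>1)"]
    by (simp add: center_def disk_at_def add_divide_distrib diff_divide_distrib)
  also have "\<bar>of_int (k\<^sub>0 - k\<^sub>1) :: real\<bar> = 1" using z(5) by linarith
  also have "\<bar>of_int (m - m') / real n\<bar> \<le> 1 / 3"
    using z(3,4) n3 by (auto simp: field_simps)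
  finally show "dist (center n (zigzag c k N j)) (center n (zigzag c k N (Suc j))) \<le> 4 / 3"
    unfolding z(1,2) by simp
qed

lemma zigzag_turn:
  "turn (zigzag c k N j) (zigzag c k N (Suc j)) (zigzag c k N (Suc (Suc j)))"
  "turn_word (zigzag c k N j) (zigzag c k N (Suc j)) (zigzag c k N (Suc (Suc j))) =
     (if j < N then [b\<^sub>2] else [])"
proof -
  have n2: "2 < int n" using n3 by simp
  have "turn (zigzag c k N j) (zigzag c k N (Suc j)) (zigzag c k N (Suc (Suc j))) \<and>
    turn_word (zigzag c k N j) (zigzag c k N (Suc j)) (zigzag c k N (Suc (Suc j))) =
     (if j < N then [b\<^sub>2] else [])"
  proof (cases "j < N")
    case True
    then show ?thesis
      using n2 by (auto simp: zigzag_def zigzag_index_def turn_def turn_word_def) (auto simp: disk_at_def)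
  next
    case False
    then have "snd (zigzag c k N j) = snd (zigzag c k N (Suc (Suc j)))"
      by (simp add: zigzag_def zigzag_index_bounce)
    then show ?thesis using False same_row_turn by simp
  qed
  then show "turn (zigzag c k N j) (zigzag c k N (Suc j)) (zigzag c k N (Suc (Suc j)))"
    "turn_word (zigzag c k N j) (zigzag c k N (Suc j)) (zigzag c k N (Suc (Suc j))) =
     (if j < N then [b\<^sub>2] else [])" by auto
qed

lemma zigzag_route_and_word:
  assumes "i < m"
  shows "route (map (zigzag c k N) [i..<m]) \<and>
    (N + 2 \<le> m \<longrightarrow> route_word (map (zigzag c k N) [i..<m]) = replicate (N - i) b\<^sub>2)"
proof -
  have "i \<le> m - 1" using assms by simp
  then show ?thesis
  proof (induction i rule: inc_induct)
    case base
    have "[m - 1..<m] = [m - 1]" using assms by (simp add: upt_rec)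
    then show ?case by simp
  next
    case (step i)
    show ?case
    proof (cases "Suc (Suc i) < m")
      case True
      have split: "map (zigzag c k N) [i..<m] = zigzag c k N i # map (zigzag c k N) [Suc i..<m]"
        "map (zigzag c k N) [Suc i..<m] = zigzag c k N (Suc i) # zigzag c k N (Suc (Suc i)) #
          map (zigzag c k N) [Suc (Suc (Suc i))..<m]"
        using True by (simp_all add: upt_conv_Cons)
      have "N - i = (if i < N then Suc (N - Suc i) else N - Suc i)" by auto
      then show ?thesis
        using step.IH zigzag_leg[of c k N i] zigzag_turn[of c k N i] unfolding split by simp
    next
      case False
      then have m: "m = Suc (Suc i)" using step by auto
      then have "map (zigzag c k N) [i..<m] = [zigzag c k N i, zigzag c k N (Suc i)]"
        by (simp add: upt_conv_Cons)
      then show ?thesis using zigzag_leg[of c k N i] m by auto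
    qed
  qed
qed

lemma zigzag_opens_upward: "2 \<le> m \<Longrightarrow> opens_upward c k (map (zigzag c k N) [0..<m])"
  by (auto simp: opens_upward_def upt_conv_Cons zigzag_def zigzag_index_def Let_def)

text \<open>
  With each further bounce the duration of the shortest trajectory grows by at most 2, and it tends to
  infinity, whereas the word remains the same. So some number of bounces leads into any given window of
  length 2 beyond the duration without bounces. Legs of the fast part take less than time 2, too, which gives
  the bound \<open>B + 2 * real N\<close>, where \<open>B\<close> accounts for the part that spells \<open>u\<close> and the first
  leg after it.
\<close>
lemma word_realized:
  assumes u: "set u \<subseteq> letters n" and red: "\<And>N. reduced_word (u @ replicate N b\<^sub>2)"
  shows "\<exists>B\<ge>0. \<forall>N \<tau>. B + 2 * real N \<le> \<tau> \<longrightarrow> (\<exists>T x v. \<tau> \<le> T \<and> T \<le> \<tau> + 2 \<and>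
    billiard_segment n r T x v \<and> admissible n r T x \<and>
    pi1_element n r T x (u @ replicate N b\<^sub>2))"
proof -
  obtain qs c k where qs: "\<And>qs'. route qs' \<Longrightarrow> opens_upward c k qs' \<Longrightarrow>
      route (qs @ qs') \<and> opens_upward 0 0 (qs @ qs') \<and>
      free_reduce (route_word (qs @ qs')) = foldr cons_reduce u (free_reduce (route_word qs'))"
    using word_route_exists[OF u, of 0 0] by blast
  define B where "B = 3 * (real (length qs) + 2)"
  show ?thesis
  proof (rule exI[of _ B], intro conjI allI impI)
    fix N \<tau> assume \<tau>: "B + 2 * real N \<le> \<tau>"
    define rt where "rt j = qs @ map (zigzag c k N) [0..<Suc (Suc j)]" for j
    have rtS: "rt (Suc j) = rt j @ [zigzag c k N (Suc (Suc j))]" for j by (simp add: rt_def)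
    have len: "length (rt j) = length qs + j + 2" for j by (simp add: rt_def)
    have last: "last (rt j) = zigzag c k N (Suc j)" for j by (simp add: rt_def)
    have tail: "route (map (zigzag c k N) [0..<Suc (Suc j)])"
      "opens_upward c k (map (zigzag c k N) [0..<Suc (Suc j)])" for j
      using zigzag_route_and_word[of 0 "Suc (Suc j)" c k N] by (blast, intro zigzag_opens_upward) simp
    have route: "route (rt j)" for j
      using qs[OF tail] unfolding rt_def by blast
    define L where "L j = route_length (rt j)" for j
    have step: "L j \<le> L (Suc j)" "L (Suc j) \<le> L j + 2" for j
    proof -
      have "2 \<le> length (rt j)" by (simp add: len)
      note app = route_length_append[OF route this]
      show "L j \<le> L (Suc j)" unfolding L_def rtS by (rule app(1))
      show "L (Suc j) \<le> L j + 2"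
        unfolding L_def rtS
        using app(2)[of "zigzag c k N (Suc (Suc j))"] zigzag_leg(3)[of c k N "Suc j"] last r_less_300th
        by fastforce
    qed
    have L_upper: "L j \<le> B + 2 * real j" for j
    proof (induction j)
      case 0
      show ?case using route_length_bounds(2)[OF route[of 0]] by (simp add: L_def len B_def)
    next
      case (Suc j)
      then show ?case using step(2)[of j] by simp
    qed
    have L_lower: "real j / 2 \<le> L j" for j
      using route_length_bounds(1)[OF route[of j]] by (simp add: L_def len)
    define P where "P j \<longleftrightarrow> N \<le> j \<and> \<tau> \<le> L j" for j
    obtain j\<^sub>1 :: nat where j1: "max (2 * \<tau>) (real N) \<le> real j\<^sub>1" using real_arch_simple by blast
    then have "P j\<^sub>1" using L_lower[of j\<^sub>1] by (simp add: P_def)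
    define j where "j = (LEAST j. P j)"
    have Pj: "P j" unfolding j_def by (rule LeastI) fact
    have "L j \<le> \<tau> + 2"
    proof (cases "j = N")
      case True
      then show ?thesis using L_upper[of N] \<tau> by simp
    next
      case False
      then obtain j' where j': "j = Suc j'" "N \<le> j'" using Pj by (cases j) (auto simp: P_def)
      then have "\<not> P j'" using not_less_Least[of j' P] by (simp add: j_def)
      then show ?thesis using step(2)[of j'] j' by (simp add: P_def)
    qed
    obtain x v where xv: "billiard_segment n r (L j) x v" "admissible n r (L j) x"
      "pi1_element n r (L j) x (free_reduce (route_word (rt j)))"
      unfolding L_def by (rule route_realized[OF route[of j]]) (auto simp: len)
    have "route_word (map (zigzag c k N) [0..<Suc (Suc j)]) = replicate N b\<^sub>2"
      using zigzag_route_and_word[of 0 "Suc (Suc j)" c k N] Pj by (simp add: P_def del: upt_Suc)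
    then have "free_reduce (route_word (rt j)) = foldr cons_reduce u (free_reduce (replicate N b\<^sub>2))"
      using qs[OF tail, of j] by (simp add: rt_def del: upt_Suc)
    also have "\<dots> = free_reduce (u @ replicate N b\<^sub>2)" by (simp add: free_reduce_append)
    also have "\<dots> = u @ replicate N b\<^sub>2" by (rule free_reduce_reduced[OF red])
    finally show "\<exists>T x v. \<tau> \<le> T \<and> T \<le> \<tau> + 2 \<and> billiard_segment n r T x v \<and> admissible n r T x \<and>
        pi1_element n r T x (u @ replicate N b\<^sub>2)"
      using xv Pj \<open>L j \<le> \<tau> + 2\<close> by (intro exI[of _ "L j"] exI[of _ x] exI[of _ v]) (simp add: P_def)
  qed (simp add: B_def)
qed

end

section \<open>Speeds and ends\<close>

lemma reduced_end_prefix: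
  assumes "e \<in> ends n"
  shows "reduced_word (map e [0..<m])"
proof (induction m)
  case (Suc m)
  have "e (Suc k) \<noteq> inv_letter (e k)" for k using assms by (simp add: ends_def)
  then show ?case
    using Suc by (cases m) (auto simp: reduced_word_def successively_append_iff)
qed simp

lemma reduced_replicate_positive: "reduced_word (replicate N (g, True))"
proof (induction N)
  case (Suc N)
  then show ?case by (cases N) (auto simp: inv_letter_def)
qed simp

context small_disks
begin

text \<open>
  If the prefix ends with the inverse of \<open>b\<^sub>2\<close>, the fast part would cancel it; a letter \<open>a\<close> in between
  prevents this.
\<close>
lemma end_prefix_extended:
  assumes e: "e \<in> ends n"
  obtains u where "set u \<subseteq> letters n" "take m u = map e [0..<m]" "m \<le> length u"
    "\<And>N. reduced_word (u @ replicate N b\<^sub>2)"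
proof -
  define w where "w = map e [0..<m]"
  define u where "u = (if w \<noteq> [] \<and> last w = inv_letter b\<^sub>2 then w @ [(Gen_a, True)] else w)"
  have w: "set w \<subseteq> letters n" "reduced_word w" "length w = m"
    using e reduced_end_prefix[OF e] by (auto simp: w_def ends_def)
  have "(Gen_a, True) \<in> letters n" by (simp add: letters_def)
  then have "set u \<subseteq> letters n" "take m u = w" "m \<le> length u" using w by (auto simp: u_def)
  moreover have "reduced_word (u @ replicate N b\<^sub>2)" for N
  proof -
    have "hd (replicate N b\<^sub>2) = b\<^sub>2" if "N > 0" using that by (cases N) auto
    moreover have "b\<^sub>2 \<noteq> inv_letter (last w)" if "last w \<noteq> inv_letter b\<^sub>2"
      using that by (metis inv_letter_inv_letter)
    ultimately show ?thesis
      using w(2) reduced_replicate_positive[of N "Gen_b 2"]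
      by (auto simp: u_def reduced_word_def successively_append_iff inv_letter_def)
  qed
  ultimately show thesis using that by (simp add: w_def)
qed

text \<open>
  For positive \<open>s\<close> the target for the duration is the word length divided by \<open>s\<close>, which is at least \<open>11/5\<close>
  of the word length because \<open>11/5 \<le> \<surd>5\<close>. For large \<open>N\<close> the surplus over \<open>2 * N\<close> exceeds \<open>B\<close>, and the
  target can be met up to an error of 2, hence the speed up to an error of order \<open>1/m\<close>.
\<close>
lemma speed_and_prefix_realized:
  assumes e: "e \<in> ends n" and s: "0 \<le> s" "s \<le> 1 / sqrt 5"
  shows "\<exists>T x v g. billiard_segment n r T x v \<and> admissible n r T x \<and> pi1_element n r T x g \<and>
     real m \<le> T \<and> \<bar>real (length g) / T - s\<bar> \<le> 2 / (real m + 1) \<and>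
     (s > 0 \<longrightarrow> take m g = map e [0..<m])"
proof (cases "s = 0")
  case True
  obtain B where B: "B \<ge> 0" "\<And>N \<tau>. B + 2 * real N \<le> \<tau> \<Longrightarrow> \<exists>T x v. \<tau> \<le> T \<and> T \<le> \<tau> + 2 \<and>
    billiard_segment n r T x v \<and> admissible n r T x \<and> pi1_element n r T x ([] @ replicate N b\<^sub>2)"
    using word_realized[of "[]"] reduced_replicate_positive by auto
  obtain T x v where "B + real m \<le> T" "billiard_segment n r T x v" "admissible n r T x"
    "pi1_element n r T x []"
    using B(2)[of 0 "B + real m"] by auto
  then show ?thesis
    using B(1) True by (intro exI[of _ T] exI[of _ x] exI[of _ v] exI[of _ "[]"]) auto
next
  case False
  then have s0: "0 < s" using s by simp
  obtain u where u: "set u \<subseteq> letters n" "take m u = map e [0..<m]" "m \<le> length u"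
    "\<And>N. reduced_word (u @ replicate N b\<^sub>2)"
    using end_prefix_extended[OF e] by blast
  obtain B where B: "B \<ge> 0" "\<And>N \<tau>. B + 2 * real N \<le> \<tau> \<Longrightarrow> \<exists>T x v. \<tau> \<le> T \<and> T \<le> \<tau> + 2 \<and>
    billiard_segment n r T x v \<and> admissible n r T x \<and> pi1_element n r T x (u @ replicate N b\<^sub>2)"
    using word_realized[OF u(1,4)] by blast
  obtain N :: nat where "max (5 * B) (real m + 1) \<le> real N" using real_arch_simple by blast
  then have N: "5 * B \<le> real N" "real m + 1 \<le> real N" by auto
  define a where "a = real (length u) + real N"
  have "(11 / 5 :: real) \<le> sqrt 5" by (rule real_le_rsqrt) (simp add: power2_eq_square)
  then have "s * (11 / 5) \<le> 1 / sqrt 5 * sqrt 5" using s by (intro mult_mono) auto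
  then have "s * (11 / 5) \<le> 1" by simp
  moreover have a: "0 \<le> a" "real N \<le> a" by (auto simp: a_def)
  ultimately have "a * (s * (11 / 5)) \<le> a * 1" by (intro mult_left_mono) auto
  then have \<tau>: "11 / 5 * a \<le> a / s" using s0 by (simp add: pos_le_divide_eq mult.commute mult.left_commute)
  have "B + 2 * real N \<le> a / s" using \<tau> a N by linarith
  from B(2)[OF this] obtain T x v where T: "a / s \<le> T" "T \<le> a / s + 2"
    and xv: "billiard_segment n r T x v" "admissible n r T x" "pi1_element n r T x (u @ replicate N b\<^sub>2)"
    by blast
  have Ta: "real m + 1 \<le> T" using T \<tau> a N by linarith
  have "s * T - a = s * (T - a / s)" using s0 by (simp add: right_diff_distrib)
  then have "0 \<le> s * T - a" "s * T - a \<le> s * 2"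
    using T s0 by (auto intro!: mult_left_mono)
  moreover have "s \<le> 1" using \<open>s * (11 / 5) \<le> 1\<close> s0 by simp
  ultimately have "\<bar>a - s * T\<bar> \<le> 2" by linarith
  then have "\<bar>a - s * T\<bar> / T \<le> 2 / (real m + 1)" using Ta by (intro frac_le) auto
  moreover have "a / T - s = (a - s * T) / T" using Ta by (simp add: diff_divide_distrib)
  ultimately have "\<bar>a / T - s\<bar> \<le> 2 / (real m + 1)" using Ta by simp
  moreover have "real (length (u @ replicate N b\<^sub>2)) = a" by (simp add: a_def)
  moreover have "take m (u @ replicate N b\<^sub>2) = map e [0..<m]" using u(2,3) by simp
  ultimately show ?thesis using xv Ta by (intro exI[of _ T] exI[of _ x] exI[of _ v] exI) auto
qed

lemma cone_point_in_rotation_set: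
  assumes e: "e \<in> ends n" and s: "0 \<le> s" "s \<le> 1 / sqrt 5"
  shows "cone_point n s e \<in> admissible_rotation_set n r"
proof -
  obtain T x v g where TX: "\<And>m. billiard_segment n r (T m) (x m) (v m)"
    "\<And>m. admissible n r (T m) (x m)" "\<And>m. pi1_element n r (T m) (x m) (g m)"
    "\<And>m. real m \<le> T m" "\<And>m. \<bar>real (length (g m)) / T m - s\<bar> \<le> 2 / (real m + 1)"
    "\<And>m. s > 0 \<Longrightarrow> take m (g m) = map e [0..<m]"
    using speed_and_prefix_realized[OF e s] by metis
  have "filterlim T at_top sequentially"
    by (rule filterlim_at_top_mono[OF filterlim_real_sequentially]) (simp add: TX(4))
  moreover have "(\<lambda>m. real (length (g m)) / T m) \<longlonglongrightarrow> s"
  proof (rule LIM_zero_cancel, rule Lim_null_comparison)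
    show "\<forall>\<^sub>F m in sequentially. norm (real (length (g m)) / T m - s) \<le> 2 / (real m + 1)"
      using TX(5) by simp
    show "(\<lambda>m. 2 / (real m + 1)) \<longlonglongrightarrow> 0"
      using tendsto_mult_right[OF LIMSEQ_inverse_real_of_nat, of 2] by (simp add: divide_inverse add.commute)
  qed
  moreover have "converges_to_end g e" if "s > 0"
    unfolding converges_to_end_def
  proof
    fix k
    have "take k (g m) = map e [0..<k]" if "k \<le> m" for m
    proof -
      have "take k (g m) = take k (take m (g m))" using \<open>k \<le> m\<close> by (simp add: min_def)
      then show ?thesis using TX(6)[OF \<open>s > 0\<close>, of m] \<open>k \<le> m\<close> by (simp add: take_map)
    qed
    then show "\<forall>\<^sub>F m in sequentially. take k (g m) = map e [0..<k]"
      by (rule eventually_sequentiallyI)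
  qed
  ultimately show ?thesis
    unfolding admissible_rotation_set_def using e s TX(1-3) by blast
qed

end

theorem theorem2p2:
  shows "\<exists>K::real. K > 0 \<and>
           (\<forall>n::nat. n \<ge> 1 \<and> 1 / sqrt 5 - K / real n \<ge> 0 \<longrightarrow>
              (\<exists>r0::real. r0 > 0 \<and>
                 (\<forall>r::real. 0 < r \<and> r < r0 \<longrightarrow>
                    cone_ball n (1 / sqrt 5 - K / real n) \<subseteq> admissible_rotation_set n r)))"
proof (rule exI[of _ 2], intro conjI allI impI)
  \<comment> \<open>For \<open>K = 2\<close> the hypothesis makes \<open>n\<close> at least 3, since \<open>2 \<le> \<surd>5\<close>.\<close>
  fix n :: nat assume n: "n \<ge> 1 \<and> 1 / sqrt 5 - 2 / real n \<ge> 0"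
  have sqrt2: "(2::real) \<le> sqrt 5" by (rule real_le_rsqrt) simp
  have "2 / real n \<le> 1 / sqrt 5" using n by simp
  also have "\<dots> \<le> 1 / 2" using sqrt2 by (intro divide_left_mono) auto
  finally have n3: "3 \<le> n" using n by (simp add: field_simps)
  show "\<exists>r0>0. \<forall>r. 0 < r \<and> r < r0 \<longrightarrow>
      cone_ball n (1 / sqrt 5 - 2 / real n) \<subseteq> admissible_rotation_set n r"
  proof (rule exI[of _ "1 / (100 * real n)"], intro conjI allI impI subsetI)
    show "0 < 1 / (100 * real n)" using n3 by simp
    fix r :: real and X
    assume r: "0 < r \<and> r < 1 / (100 * real n)" and X: "X \<in> cone_ball n (1 / sqrt 5 - 2 / real n)"
    interpret small_disks n r
      by unfold_locales (use r n3 in \<open>auto simp: field_simps\<close>)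
    obtain s e where "X = cone_point n s e" "0 \<le> s" "s \<le> 1 / sqrt 5 - 2 / real n" "e \<in> ends n"
      using X by (auto simp: cone_ball_def)
    moreover from this have "s \<le> 1 / sqrt 5" using n3 by (smt (verit) divide_nonneg_nonneg of_nat_0_le_iff)
    ultimately show "X \<in> admissible_rotation_set n r" using cone_point_in_rotation_set by simp
  qed
qed simp

end
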